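(* Let $\mathcal B$ be either the category $\mathcal R(\sigma)$ of $\sigma$-structures, for a fixed relational signature $\sigma$, or the category $\mathbf{Graph}$ of graphs. Let $\Delta$ be a component-based class of finite objects of $\mathcal B$ and let $\asymp$ be the binary relation on finite objects of $\mathcal B$ such that, for any two finite objects $A,B$, $$A\asymp B\iff \hom(C,A)\cong\hom(C,B)\ \text{ for all } C\in\Delta,$$ where $\cong$ denotes existence of a bijection of sets. Then the comonad $\mathbb D_\Delta$ (defined in the context), which classifies $\Delta$, also classifies $\asymp$: for all finite objects $A,B$ of $\mathcal B$, $A\asymp B$ if and only if the cofree $\mathbb D_\Delta$-coalgebras on $A$ and on $B$ are isomorphic in the category of $\mathbb D_\Delta$-coalgebras.
   Context: A relational signature $\sigma$ is a set of relation symbols of positive finite arity. Objects of $\mathcal R(\sigma)$ are arbitrary (possibly infinite or empty) $\sigma$-structures with homomorphisms (relation-preserving functions). Objects of $\mathbf{Graph}$ are undirected loopless graphs (possibly infinite or empty), with edge-preserving functions. Coproducts are disjoint unions. A class $\Delta$ of finite objects is component-based if it is closed under isomorphisms, under finite coproducts (including the empty one), and under summands (if $A+B\in\Delta$ then $A,B\in\Delta$). An object $C$ is connected if every morphism $C\to\coprod_i A_i$ into a coproduct factors uniquely through exactly one of the coproduct inclusions (for $\mathcal R(\sigma)$: nonempty with connected Gaifman graph; for $\mathbf{Graph}$: nonempty connected graphs). The comonad $\mathbb D_\Delta$: let $\mathcal A$ be a set consisting of exactly one representative of each isomorphism class of connected objects in $\Delta$. For an object $B$ put $\mathbb D_\Delta(B)=\coprod_{A\in\mathcal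 A}\coprod_{f\colon A\to B}A$, with $\iota_f\colon A\to\mathbb D_\Delta(B)$ the inclusion of the summand indexed by $f\colon A\to B$. For $h\colon B\to B'$, $\mathbb D_\Delta(h)$ is determined by $\mathbb D_\Delta(h)\circ\iota_f=\iota_{h\circ f}$; the counit $\varepsilon$ and comultiplication $\delta$ are determined by $\varepsilon_B\circ\iota_f=f$ and $\delta_B\circ\iota_f=\iota_{\iota_f}$. (This is the density comonad of the inclusion of the discrete category $\mathcal A$ into $\mathcal B$.) For a comonad $(\mathbb C,\varepsilon,\delta)$, coalgebras are Eilenberg--Moore coalgebras: morphisms $\alpha\colon X\to\mathbb C(X)$ with $\varepsilon_X\circ\alpha=\mathrm{id}$ and $\delta_X\circ\alpha=\mathbb C(\alpha)\circ\alpha$; a morphism $(X,\alpha)\to(Y,\beta)$ is a morphism $h\colon X\to Y$ with $\beta\circ h=\mathbb C(h)\circ\alpha$. The cofree coalgebra on $A$ is $\delta_A\colon\mathbb C(A)\to\mathbb C^2(A)$. $\mathbb C$ classifies $\Delta$ if a finite object is in $\Delta$ exactly when it admits a $\mathbb C$-coalgebra. *)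

theory Defs
  imports Main "HOL-Library.FuncSet" "HOL-Library.Equipollence"
begin

section \<open>The categories of relational structures and of graphs\<close>

record 's signature =
  symbols :: "'s set"
  arity :: "'s \<Rightarrow> nat"

definition relational_signature :: "'s signature \<Rightarrow> bool" where
  "relational_signature \<sigma> \<longleftrightarrow> (\<forall>R\<in>symbols \<sigma>. 0 < arity \<sigma> R)"

record ('a, 's) rel_structure =
  univ :: "'a set"
  rel :: "'s \<Rightarrow> 'a list set"

text \<open>
  A graph is a structure whose only relation is a binary adjacency relation, named \<open>E\<close>, which is
  symmetric and irreflexive.  Morphisms of graphs are then just morphisms of structures.
\<close>

datatype 's base_category = Rel_Structures "'s signature" | Graphs 's

definition is_structure :: "'s signature \<Rightarrow> ('a, 's) rel_structure \<Rightarrow> bool" where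
  "is_structure \<sigma> X \<longleftrightarrow>
     (\<forall>R\<in>symbols \<sigma>. \<forall>t\<in>rel X R. length t = arity \<sigma> R \<and> set t \<subseteq> univ X) \<and>
     (\<forall>R. R \<notin> symbols \<sigma> \<longrightarrow> rel X R = {})"

fun is_object :: "'s base_category \<Rightarrow> ('a, 's) rel_structure \<Rightarrow> bool" where
  "is_object (Rel_Structures \<sigma>) X \<longleftrightarrow> is_structure \<sigma> X"
| "is_object (Graphs E) X \<longleftrightarrow>
     is_structure \<lparr>symbols = {E}, arity = (\<lambda>_. 2)\<rparr> X \<and>
     (\<forall>x y. [x, y] \<in> rel X E \<longrightarrow> [y, x] \<in> rel X E) \<and>
     (\<forall>x. [x, x] \<notin> rel X E)"

definition finite_object :: "'s base_category \<Rightarrow> ('a, 's) rel_structure \<Rightarrow> bool" where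
  "finite_object \<B> X \<longleftrightarrow> is_object \<B> X \<and> finite (univ X)"

text \<open>
  Morphisms are extensional functions (\<open>undefined\<close> outside the universe of the domain), so that
  equality of morphisms is equality in HOL and hom-sets have the right cardinality.
\<close>

definition hom :: "('a, 's) rel_structure \<Rightarrow> ('b, 's) rel_structure \<Rightarrow> ('a \<Rightarrow> 'b) set" where
  "hom X Y = {f \<in> univ X \<rightarrow>\<^sub>E univ Y. \<forall>R. \<forall>t\<in>rel X R. map f t \<in> rel Y R}"

abbreviation ident :: "('a, 's) rel_structure \<Rightarrow> 'a \<Rightarrow> 'a" where
  "ident X \<equiv> (\<lambda>x\<in>univ X. x)"

abbreviation comp_from :: "('a, 's) rel_structure \<Rightarrow> ('b \<Rightarrow> 'c) \<Rightarrow> ('a \<Rightarrow> 'b) \<Rightarrow> 'a \<Rightarrow> 'c" where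
  "comp_from X \<equiv> compose (univ X)"

definition iso_objects :: "('a, 's) rel_structure \<Rightarrow> ('b, 's) rel_structure \<Rightarrow> bool" where
  "iso_objects X Y \<longleftrightarrow>
     (\<exists>f\<in>hom X Y. \<exists>g\<in>hom Y X. comp_from X g f = ident X \<and> comp_from Y f g = ident Y)"

definition coprod :: "'i set \<Rightarrow> ('i \<Rightarrow> ('a, 's) rel_structure) \<Rightarrow> ('i \<times> 'a, 's) rel_structure" where
  "coprod I A = \<lparr>univ = Sigma I (\<lambda>i. univ (A i)),
                 rel = (\<lambda>R. \<Union>i\<in>I. map (Pair i) ` rel (A i) R)\<rparr>"

definition coprod_in :: "('i \<Rightarrow> ('a, 's) rel_structure) \<Rightarrow> 'i \<Rightarrow> 'a \<Rightarrow> 'i \<times> 'a" where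
  "coprod_in A i = (\<lambda>a\<in>univ (A i). (i, a))"

definition gaifman :: "('a, 's) rel_structure \<Rightarrow> ('a \<times> 'a) set" where
  "gaifman X = {(x, y). x \<noteq> y \<and> (\<exists>R. \<exists>t\<in>rel X R. x \<in> set t \<and> y \<in> set t)}"

text \<open>
  For a graph, the Gaifman graph is the graph itself.  That connectedness is equivalent to the
  factorisation property with respect to coproducts is shown below.
\<close>

definition connected_object :: "('a, 's) rel_structure \<Rightarrow> bool" where
  "connected_object X \<longleftrightarrow>
     univ X \<noteq> {} \<and> (\<forall>x\<in>univ X. \<forall>y\<in>univ X. (x, y) \<in> (gaifman X)\<^sup>*)"


section \<open>Component-based classes\<close>

text \<open>
  An isomorphism-closed class of finite objects is determined by its members with universe
  contained in \<^typ>\<open>nat\<close>, and is represented by the set of these.  Membership of an object over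
  another type means being isomorphic to an element of that set.
\<close>

definition in_class :: "(nat, 's) rel_structure set \<Rightarrow> ('a, 's) rel_structure \<Rightarrow> bool" where
  "in_class \<Delta> X \<longleftrightarrow> (\<exists>Y\<in>\<Delta>. iso_objects X Y)"

definition component_based :: "'s base_category \<Rightarrow> (nat, 's) rel_structure set \<Rightarrow> bool" where
  "component_based \<B> \<Delta> \<longleftrightarrow>
     (\<forall>A\<in>\<Delta>. finite_object \<B> A) \<and>
     (\<forall>A\<in>\<Delta>. \<forall>B. is_object \<B> B \<and> iso_objects A B \<longrightarrow> B \<in> \<Delta>) \<and>
     (\<forall>(I :: nat set) A. finite I \<and> (\<forall>i\<in>I. A i \<in> \<Delta>) \<longrightarrow> in_class \<Delta> (coprod I A)) \<and>
     (\<forall>A B. is_object \<B> A \<and> is_object \<B> B \<and>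
        in_class \<Delta> (coprod (UNIV :: bool set) (\<lambda>b. if b then A else B)) \<longrightarrow> A \<in> \<Delta> \<and> B \<in> \<Delta>)"

definition connected_representatives ::
  "'s base_category \<Rightarrow> (nat, 's) rel_structure set \<Rightarrow> ('c, 's) rel_structure set \<Rightarrow> bool" where
  "connected_representatives \<B> \<Delta> \<A> \<longleftrightarrow>
     (\<forall>A\<in>\<A>. is_object \<B> A \<and> connected_object A \<and> in_class \<Delta> A) \<and>
     (\<forall>C\<in>\<Delta>. connected_object C \<longrightarrow> (\<exists>!A. A \<in> \<A> \<and> iso_objects C A))"

definition hom_equiv ::
  "(nat, 's) rel_structure set \<Rightarrow> ('a, 's) rel_structure \<Rightarrow> ('b, 's) rel_structure \<Rightarrow> bool" where
  "hom_equiv \<Delta> A B \<longleftrightarrow> (\<forall>C\<in>\<Delta>. hom C A \<approx> hom C B)"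


section \<open>The density comonad and its coalgebras\<close>

text \<open>Elements of \<open>density \<A> B\<close> are triples \<open>(A, f, a)\<close> with \<open>f : A \<rightarrow> B\<close> and \<open>a\<close> in \<open>A\<close>.\<close>

type_synonym ('c, 'b, 's) density_elt = "('c, 's) rel_structure \<times> ('c \<Rightarrow> 'b) \<times> 'c"

definition density ::
  "('c, 's) rel_structure set \<Rightarrow> ('b, 's) rel_structure \<Rightarrow> (('c, 'b, 's) density_elt, 's) rel_structure" where
  "density \<A> B = coprod \<A> (\<lambda>A. coprod (hom A B) (\<lambda>_. A))"

definition density_in :: "('c, 's) rel_structure \<Rightarrow> ('c \<Rightarrow> 'b) \<Rightarrow> 'c \<Rightarrow> ('c, 'b, 's) density_elt" where
  "density_in A f = (\<lambda>a\<in>univ A. (A, f, a))"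

definition density_map ::
  "('c, 's) rel_structure set \<Rightarrow> ('b, 's) rel_structure \<Rightarrow> ('b \<Rightarrow> 'd) \<Rightarrow>
   ('c, 'b, 's) density_elt \<Rightarrow> ('c, 'd, 's) density_elt" where
  "density_map \<A> B h = (\<lambda>(A, f, a)\<in>univ (density \<A> B). density_in A (comp_from A h f) a)"

definition counit ::
  "('c, 's) rel_structure set \<Rightarrow> ('b, 's) rel_structure \<Rightarrow> ('c, 'b, 's) density_elt \<Rightarrow> 'b" where
  "counit \<A> B = (\<lambda>(A, f, a)\<in>univ (density \<A> B). f a)"

definition comult ::
  "('c, 's) rel_structure set \<Rightarrow> ('b, 's) rel_structure \<Rightarrow>
   ('c, 'b, 's) density_elt \<Rightarrow> ('c, ('c, 'b, 's) density_elt, 's) density_elt" where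
  "comult \<A> B = (\<lambda>(A, f, a)\<in>univ (density \<A> B). density_in A (density_in A f) a)"

definition coalgebra ::
  "('c, 's) rel_structure set \<Rightarrow> ('x, 's) rel_structure \<Rightarrow> ('x \<Rightarrow> ('c, 'x, 's) density_elt) \<Rightarrow> bool" where
  "coalgebra \<A> X \<alpha> \<longleftrightarrow>
     \<alpha> \<in> hom X (density \<A> X) \<and>
     comp_from X (counit \<A> X) \<alpha> = ident X \<and>
     comp_from X (comult \<A> X) \<alpha> = comp_from X (density_map \<A> X \<alpha>) \<alpha>"

definition coalgebra_hom ::
  "('c, 's) rel_structure set \<Rightarrow>
   ('x, 's) rel_structure \<times> ('x \<Rightarrow> ('c, 'x, 's) density_elt) \<Rightarrow>
   ('y, 's) rel_structure \<times> ('y \<Rightarrow> ('c, 'y, 's) density_elt) \<Rightarrow> ('x \<Rightarrow> 'y) set" where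
  "coalgebra_hom \<A> = (\<lambda>(X, \<alpha>) (Y, \<beta>).
     {h \<in> hom X Y. comp_from X \<beta> h = comp_from X (density_map \<A> X h) \<alpha>})"

definition coalgebra_iso ::
  "('c, 's) rel_structure set \<Rightarrow>
   ('x, 's) rel_structure \<times> ('x \<Rightarrow> ('c, 'x, 's) density_elt) \<Rightarrow>
   ('y, 's) rel_structure \<times> ('y \<Rightarrow> ('c, 'y, 's) density_elt) \<Rightarrow> bool" where
  "coalgebra_iso \<A> P Q \<longleftrightarrow>
     (\<exists>h\<in>coalgebra_hom \<A> P Q. \<exists>k\<in>coalgebra_hom \<A> Q P.
        comp_from (fst P) k h = ident (fst P) \<and> comp_from (fst Q) h k = ident (fst Q))"

definition cofree ::
  "('c, 's) rel_structure set \<Rightarrow> ('b, 's) rel_structure \<Rightarrow>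
   (('c, 'b, 's) density_elt, 's) rel_structure \<times>
   (('c, 'b, 's) density_elt \<Rightarrow> ('c, ('c, 'b, 's) density_elt, 's) density_elt)" where
  "cofree \<A> B = (density \<A> B, comult \<A> B)"


section \<open>Adequacy of the definitions\<close>

lemma homD:
  assumes "f \<in> hom X Y"
  shows "x \<in> univ X \<Longrightarrow> f x \<in> univ Y" "t \<in> rel X R \<Longrightarrow> map f t \<in> rel Y R" "f \<in> extensional (univ X)"
  using assms by (auto simp: hom_def PiE_def)

lemma rel_subset_univ: "is_object \<B> X \<Longrightarrow> t \<in> rel X R \<Longrightarrow> set t \<subseteq> univ X"
proof (cases \<B>)
  case (Rel_Structures \<sigma>)
  assume "is_object \<B> X" "t \<in> rel X R"
  then show ?thesis using Rel_Structures by (cases "R \<in> symbols \<sigma>") (auto simp: is_structure_def)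
next
  case (Graphs E)
  assume "is_object \<B> X" "t \<in> rel X R"
  then show ?thesis using Graphs by (cases "R = E") (auto simp: is_structure_def)
qed

lemma map_compose: "is_object \<B> X \<Longrightarrow> t \<in> rel X R \<Longrightarrow> map (comp_from X g f) t = map g (map f t)"
  using rel_subset_univ[of \<B> X t R] by (auto simp: compose_def)

lemma hom_compose:
  assumes "is_object \<B> X" "f \<in> hom X Y" "g \<in> hom Y Z"
  shows "comp_from X g f \<in> hom X Z"
proof -
  have "map (comp_from X g f) t \<in> rel Z R" if "t \<in> rel X R" for t R
    using that homD(2)[OF assms(2) that] homD(2)[OF assms(3)] map_compose[OF assms(1) that]
    by metis
  then show ?thesis
    using homD(1)[OF assms(2)] homD(1)[OF assms(3)] by (auto simp: hom_def compose_def)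
qed

lemma hom_ident: "is_object \<B> X \<Longrightarrow> ident X \<in> hom X X"
proof -
  assume X: "is_object \<B> X"
  have "map (ident X) t = t" if "t \<in> rel X R" for t R
    using rel_subset_univ[OF X that] by (auto intro!: map_idI)
  then show ?thesis by (auto simp: hom_def)
qed

lemma is_object_coprod:
  assumes "\<And>i. i \<in> I \<Longrightarrow> is_object \<B> (A i)"
  shows "is_object \<B> (coprod I A)"
proof -
  have *: "is_structure \<sigma> (coprod I A)"
    if "\<And>i. i \<in> I \<Longrightarrow> is_structure \<sigma> (A i)" for \<sigma>
    using that by (force simp: coprod_def is_structure_def)
  show ?thesis
  proof (cases \<B>)
    case (Rel_Structures \<sigma>)
    have "is_structure \<sigma> (coprod I A)"
      using assms unfolding Rel_Structures is_object.simps by (rule *)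
    then show ?thesis unfolding Rel_Structures is_object.simps .
  next
    case (Graphs E)
    have "is_structure \<lparr>symbols = {E}, arity = (\<lambda>_. 2)\<rparr> (coprod I A)"
      by (rule *) (use assms Graphs in simp)
    moreover have "[y, x] \<in> rel (coprod I A) E" if xy: "[x, y] \<in> rel (coprod I A) E" for x y
    proof -
      obtain i t where "i \<in> I" "t \<in> rel (A i) E" "[x, y] = map (Pair i) t"
        using xy by (auto simp: coprod_def)
      moreover from this obtain a b where "t = [a, b]" by (auto simp: Cons_eq_map_conv)
      moreover have "[b, a] \<in> rel (A i) E"
        using assms[OF \<open>i \<in> I\<close>] calculation Graphs by simp
      ultimately show ?thesis by (force simp: coprod_def)
    qed
    moreover have "[x, x] \<notin> rel (coprod I A) E" for x
    proof
      assume "[x, x] \<in> rel (coprod I A) E"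
      then obtain i t where "i \<in> I" "t \<in> rel (A i) E" "[x, x] = map (Pair i) t"
        by (auto simp: coprod_def)
      moreover from this obtain a where "t = [a, a]" by (auto simp: Cons_eq_map_conv)
      ultimately show False using assms[OF \<open>i \<in> I\<close>] Graphs by simp
    qed
    ultimately show ?thesis unfolding Graphs is_object.simps by (intro conjI allI impI)
  qed
qed

lemma hom_coprod_in: "is_object \<B> (A i) \<Longrightarrow> i \<in> I \<Longrightarrow> coprod_in A i \<in> hom (A i) (coprod I A)"
proof -
  assume A: "is_object \<B> (A i)" "i \<in> I"
  have *: "map (coprod_in A i) t = map (Pair i) t" if "t \<in> rel (A i) R" for t R
    using rel_subset_univ[OF A(1) that] by (auto simp: coprod_in_def)
  have "map (coprod_in A i) t \<in> rel (coprod I A) R" if "t \<in> rel (A i) R" for t R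
    using A(2) imageI[OF that, of "map (Pair i)"] unfolding *[OF that] coprod_def rel_structure.simps
    by (rule UN_I)
  then show ?thesis using A(2) by (auto simp: hom_def[of "A i" "coprod I A"] coprod_in_def) (auto simp: coprod_def)
qed

lemma rel_not_Nil:
  assumes "(\<exists>\<sigma>. relational_signature \<sigma> \<and> \<B> = Rel_Structures \<sigma>) \<or> (\<exists>E. \<B> = Graphs E)"
    and "is_object \<B> X"
  shows "[] \<notin> rel X R"
proof -
  have *: "[] \<notin> rel X R" if "relational_signature \<sigma>" "is_structure \<sigma> X" for \<sigma>
    using that by (cases "R \<in> symbols \<sigma>") (force simp: relational_signature_def is_structure_def)+
  show ?thesis
  proof (cases \<B>)
    case (Rel_Structures \<sigma>)
    then show ?thesis using * assms by auto
  next
    case (Graphs E)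
    have "relational_signature \<lparr>symbols = {E}, arity = (\<lambda>_. 2)\<rparr>"
      by (simp add: relational_signature_def)
    then show ?thesis using * assms(2) Graphs by (metis is_object.simps(2))
  qed
qed

theorem connected_factorisation:
  assumes base: "(\<exists>\<sigma>. relational_signature \<sigma> \<and> \<B> = Rel_Structures \<sigma>) \<or> (\<exists>E. \<B> = Graphs E)"
    and C: "is_object \<B> C" and conn: "connected_object C"
    and h: "h \<in> hom C (coprod I A)"
  shows "\<exists>!i. i \<in> I \<and> (\<exists>!g. g \<in> hom C (A i) \<and> h = comp_from C (coprod_in A i) g)"
proof -
  obtain c where c: "c \<in> univ C" using conn by (auto simp: connected_object_def)
  have step: "fst (h x) = fst (h y)" if xy: "(x, y) \<in> gaifman C" for x y
  proof -
    obtain R t where t: "t \<in> rel C R" "x \<in> set t" "y \<in> set t" using xy by (auto simp: gaifman_def)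
    obtain i s where "map h t = map (Pair i) s"
      using homD(2)[OF h t(1)] by (auto simp: coprod_def)
    then have "set (map h t) = set (map (Pair i) s)" by (rule arg_cong[where f = set])
    then have "h ` set t = Pair i ` set s" by simp
    then have "h x \<in> Pair i ` set s" "h y \<in> Pair i ` set s" using t by blast+
    then show ?thesis by auto
  qed
  have star: "fst (h x) = fst (h y)" if "(x, y) \<in> (gaifman C)\<^sup>*" for x y
    using that by induction (auto dest: step)
  define i where "i = fst (h c)"
  have i: "fst (h x) = i" if "x \<in> univ C" for x
    using star conn c that unfolding i_def connected_object_def by metis
  have iI: "i \<in> I" using homD(1)[OF h c] by (auto simp: i_def coprod_def)
  define g where "g = (\<lambda>x\<in>univ C. snd (h x))"
  have g_in: "g x \<in> univ (A i)" and hg: "h x = (i, g x)" if "x \<in> univ C" for x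
    using homD(1)[OF h that] i[OF that] that by (auto simp: g_def coprod_def)
  have "map g t \<in> rel (A i) R" if t: "t \<in> rel C R" for t R
  proof -
    have ne: "t \<noteq> []" using rel_not_Nil[OF base C] t by blast
    obtain j s where js: "map h t = map (Pair j) s" "s \<in> rel (A j) R"
      using homD(2)[OF h t] by (auto simp: coprod_def)
    have tC: "set t \<subseteq> univ C" using rel_subset_univ[OF C t] .
    have "map h t = map (Pair i) (map g t)" using tC hg by auto
    then have e: "map (Pair j) s = map (Pair i) (map g t)" using js by simp
    then have "j = i" using ne by (cases s; cases t) auto
    moreover have "map snd (map (Pair j) s) = map snd (map (Pair i) (map g t))"
      using e by (rule arg_cong[where f = "map snd"])
    then have "s = map g t" by (simp add: comp_def)
    ultimately show ?thesis using js(2) by simp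
  qed
  then have g: "g \<in> hom C (A i)" using g_in by (auto simp: hom_def g_def)
  have ext: "k = g" if k: "k \<in> hom C (A i)" "h = comp_from C (coprod_in A i) k" for k
  proof (rule extensionalityI[OF homD(3)[OF k(1)] homD(3)[OF g]])
    fix x assume x: "x \<in> univ C"
    have "h x = (i, k x)" using k(2) homD(1)[OF k(1) x] x by (simp add: compose_def coprod_in_def)
    then show "k x = g x" using hg[OF x] by simp
  qed
  have hcomp: "h = comp_from C (coprod_in A i) g"
  proof (rule extensionalityI[OF homD(3)[OF h]])
    fix x assume x: "x \<in> univ C"
    show "h x = comp_from C (coprod_in A i) g x"
      using hg[OF x] g_in[OF x] x by (simp add: compose_def coprod_in_def)
  qed simp
  show ?thesis
  proof (rule ex1I[of _ i])
    show "i \<in> I \<and> (\<exists>!g. g \<in> hom C (A i) \<and> h = comp_from C (coprod_in A i) g)"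
      using iI g hcomp ext by blast
  next
    fix j assume "j \<in> I \<and> (\<exists>!g. g \<in> hom C (A j) \<and> h = comp_from C (coprod_in A j) g)"
    then obtain k where k: "k \<in> hom C (A j)" "h = comp_from C (coprod_in A j) k" by blast
    have "h c = (j, k c)"
      using k(2) homD(1)[OF k(1) c] c by (simp add: compose_def coprod_in_def)
    then show "j = i" using hg[OF c] by simp
  qed
qed

lemma is_object_restrict:
  assumes "is_object \<B> X"
  shows "is_object \<B> \<lparr>univ = univ X \<inter> S, rel = (\<lambda>R. {t \<in> rel X R. set t \<subseteq> S})\<rparr>"
  using assms by (cases \<B>) (auto simp: is_structure_def)

theorem connected_if_factorisation:
  fixes C :: "('a, 's) rel_structure"
  assumes C: "is_object \<B> C"
    and fac: "\<And>(I :: bool set) (A :: bool \<Rightarrow> ('a, 's) rel_structure) h.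
      (\<And>i. i \<in> I \<Longrightarrow> is_object \<B> (A i)) \<Longrightarrow> h \<in> hom C (coprod I A) \<Longrightarrow>
      \<exists>!i. i \<in> I \<and> (\<exists>!g. g \<in> hom C (A i) \<and> h = comp_from C (coprod_in A i) g)"
  shows "connected_object C"
  unfolding connected_object_def
proof (intro conjI ballI)
  let ?A = "\<lambda>S. \<lparr>univ = univ C \<inter> S, rel = (\<lambda>R. {t \<in> rel C R. set t \<subseteq> S})\<rparr>"
  fix x y assume x: "x \<in> univ C" and y: "y \<in> univ C"
  define K where "K = {z. (x, z) \<in> (gaifman C)\<^sup>*}"
  define A where "A = (\<lambda>b. if b then ?A K else ?A (- K))"
  define h where "h = (\<lambda>z\<in>univ C. (z \<in> K, z))"
  have cell: "set t \<subseteq> K \<or> set t \<subseteq> - K" if t: "t \<in> rel C R" for t R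
  proof -
    have "v \<in> K" if "u \<in> K" "u \<in> set t" "v \<in> set t" for u v
    proof (cases "u = v")
      case False
      then have "(u, v) \<in> gaifman C" using that t by (auto simp: gaifman_def)
      then show ?thesis using that(1) unfolding K_def by (auto intro: rtrancl_into_rtrancl)
    qed (use that in simp)
    then show ?thesis by blast
  qed
  have "map h t \<in> rel (coprod UNIV A) R" if t: "t \<in> rel C R" for t R
  proof -
    have tC: "set t \<subseteq> univ C" using rel_subset_univ[OF C t] .
    obtain b where b: "\<forall>z\<in>set t. (z \<in> K) = b" using cell[OF t] by blast
    have "map h t = map (Pair b) t" using tC b by (auto simp: h_def)
    moreover have "t \<in> rel (A b) R" using t b by (cases b) (auto simp: A_def)
    ultimately have "map h t \<in> map (Pair b) ` rel (A b) R" by (rule image_eqI)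
    then show ?thesis unfolding coprod_def rel_structure.simps by (rule UN_I[OF UNIV_I])
  qed
  then have h: "h \<in> hom C (coprod UNIV A)"
    by (auto simp: hom_def h_def A_def coprod_def)
  have "is_object \<B> (A i)" for i
    using is_object_restrict[OF C] by (simp add: A_def)
  then obtain i g where g: "g \<in> hom C (A i)" "h = comp_from C (coprod_in A i) g"
    using fac[of UNIV A h] h by blast
  have "fst (h z) = i" if "z \<in> univ C" for z
    using g(2) homD(1)[OF g(1) that] that by (simp add: compose_def coprod_in_def)
  then have "(x \<in> K) = i" "(y \<in> K) = i" using x y by (auto simp: h_def)
  then show "(x, y) \<in> (gaifman C)\<^sup>*" by (auto simp: K_def)
next
  show "univ C \<noteq> {}"
  proof
    assume "univ C = {}"
    define A where "A = (\<lambda>_ :: bool. C)"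
    define h where "h = (\<lambda>z\<in>univ C. (True, z))"
    have i: "ident C \<in> hom C C" using hom_ident[OF C] .
    have uniq: "k = ident C" if "k \<in> hom C C" for k
      using homD(3)[OF that] \<open>univ C = {}\<close> by (simp add: extensional_def fun_eq_iff)
    have "comp_from C (coprod_in A b) (ident C) = h" for b
      using \<open>univ C = {}\<close> by (simp add: compose_def h_def restrict_def)
    then have "\<exists>!g. g \<in> hom C (A b) \<and> h = comp_from C (coprod_in A b) g" for b
      unfolding A_def using i uniq by metis
    moreover have "h \<in> hom C (coprod UNIV A)"
      using hom_coprod_in[of \<B> A True UNIV] C by (simp add: A_def coprod_in_def h_def)
    ultimately show False
      using fac[of UNIV A h] C unfolding A_def by (metis UNIV_I)
  qed
qed

text \<open>\<open>density\<close> is a comonad, on objects over arbitrary types.\<close>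

lemma univ_density [simp]:
  "(A, f, a) \<in> univ (density \<A> B) \<longleftrightarrow> A \<in> \<A> \<and> f \<in> hom A B \<and> a \<in> univ A"
  by (simp add: density_def coprod_def)

lemma rel_density:
  "t \<in> rel (density \<A> B) R \<longleftrightarrow>
     (\<exists>A f s. A \<in> \<A> \<and> f \<in> hom A B \<and> s \<in> rel A R \<and> t = map (\<lambda>a. (A, f, a)) s)"
proof -
  have "map (Pair A) (map (Pair f) s) = map (\<lambda>a. (A, f, a)) s" for A f and s :: "'a list"
    by simp
  then show ?thesis unfolding density_def coprod_def rel_structure.simps UN_iff image_iff Bex_def by metis
qed

context
  fixes \<B> :: "'s base_category" and \<A> :: "('c, 's) rel_structure set"
  assumes \<A>: "\<And>A. A \<in> \<A> \<Longrightarrow> is_object \<B> A"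
begin

lemma is_object_density: "is_object \<B> (density \<A> B)"
  unfolding density_def using \<A> by (intro is_object_coprod) blast

text \<open>To prove that something is a morphism from \<open>density \<A> B\<close>, check it on each summand.\<close>

lemma hom_densityI:
  assumes "k \<in> extensional (univ (density \<A> B))"
    and "\<And>A f. A \<in> \<A> \<Longrightarrow> f \<in> hom A B \<Longrightarrow> comp_from A k (density_in A f) \<in> hom A Y"
  shows "k \<in> hom (density \<A> B) Y"
proof -
  have "k (A, f, a) \<in> univ Y" if "A \<in> \<A>" "f \<in> hom A B" "a \<in> univ A" for A f a
    using homD(1)[OF assms(2)[OF that(1,2)] that(3)] that
    by (simp add: compose_def density_in_def)
  moreover have "map k t \<in> rel Y R" if "t \<in> rel (density \<A> B) R" for t R
  proof -
    obtain A f s where s: "A \<in> \<A>" "f \<in> hom A B" "s \<in> rel A R" "t = map (\<lambda>a. (A, f, a)) s"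
      using \<open>t \<in> _\<close> by (auto simp: rel_density)
    have "set s \<subseteq> univ A" using rel_subset_univ[OF \<A>[OF s(1)] s(3)] .
    then have "map (comp_from A k (density_in A f)) s = map k t"
      by (auto simp: s(4) compose_def density_in_def)
    then show ?thesis using homD(2)[OF assms(2)[OF s(1,2)] s(3)] by simp
  qed
  ultimately show ?thesis using assms(1)
    by (simp add: hom_def[of "density \<A> B" Y] PiE_def Pi_def split_paired_all)
qed

lemma hom_density_in: "A \<in> \<A> \<Longrightarrow> f \<in> hom A B \<Longrightarrow> density_in A f \<in> hom A (density \<A> B)"
proof -
  assume A: "A \<in> \<A>" and f: "f \<in> hom A B"
  have "map (density_in A f) s = map (\<lambda>a. (A, f, a)) s" if "s \<in> rel A R" for s R
    using rel_subset_univ[OF \<A>[OF A] that] by (auto simp: density_in_def)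
  then have "map (density_in A f) s \<in> rel (density \<A> B) R" if "s \<in> rel A R" for s R
    unfolding rel_density using A f that by (intro exI conjI)
  then show ?thesis using A f by (auto simp: hom_def[of A "density \<A> B"] density_in_def)
qed

lemma density_ext:
  assumes "k \<in> extensional (univ (density \<A> B))" "l \<in> extensional (univ (density \<A> B))"
    and "\<And>A f a. A \<in> \<A> \<Longrightarrow> f \<in> hom A B \<Longrightarrow> a \<in> univ A \<Longrightarrow> k (A, f, a) = l (A, f, a)"
  shows "k = l"
  using assms(1,2) by (rule extensionalityI) (use assms(3) in auto)

lemma density_map_apply:
  "A \<in> \<A> \<Longrightarrow> f \<in> hom A B \<Longrightarrow> a \<in> univ A \<Longrightarrow>
     density_map \<A> B h (A, f, a) = (A, comp_from A h f, a)"
  by (simp add: density_map_def density_in_def)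

lemma counit_apply:
  "A \<in> \<A> \<Longrightarrow> f \<in> hom A B \<Longrightarrow> a \<in> univ A \<Longrightarrow> counit \<A> B (A, f, a) = f a"
  by (simp add: counit_def)

lemma comult_apply:
  "A \<in> \<A> \<Longrightarrow> f \<in> hom A B \<Longrightarrow> a \<in> univ A \<Longrightarrow>
     comult \<A> B (A, f, a) = (A, density_in A f, a)"
  by (simp add: comult_def density_in_def)

lemma density_map_in:
  assumes "A \<in> \<A>" "f \<in> hom A B"
  shows "comp_from A (density_map \<A> B h) (density_in A f) = density_in A (comp_from A h f)"
  using assms by (auto simp: fun_eq_iff compose_def density_in_def density_map_def)

lemma counit_in:
  assumes "A \<in> \<A>" "f \<in> hom A B"
  shows "comp_from A (counit \<A> B) (density_in A f) = f"
  using assms homD(3)[OF assms(2)]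
  by (auto simp: fun_eq_iff compose_def density_in_def counit_def extensional_def)

lemma comult_in:
  assumes "A \<in> \<A>" "f \<in> hom A B"
  shows "comp_from A (comult \<A> B) (density_in A f) = density_in A (density_in A f)"
  using assms by (auto simp: fun_eq_iff compose_def density_in_def comult_def)

theorem hom_density_map:
  assumes "h \<in> hom B B'"
  shows "density_map \<A> B h \<in> hom (density \<A> B) (density \<A> B')"
proof (rule hom_densityI)
  fix A f assume *: "A \<in> \<A>" "f \<in> hom A B"
  show "comp_from A (density_map \<A> B h) (density_in A f) \<in> hom A (density \<A> B')"
    unfolding density_map_in[OF *]
    using *(1) hom_compose[OF \<A>[OF *(1)] *(2) assms] by (rule hom_density_in)
qed (simp add: density_map_def)

theorem hom_counit: "counit \<A> B \<in> hom (density \<A> B) B"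
  by (rule hom_densityI) (simp add: counit_def, simp add: counit_in)

theorem hom_comult: "comult \<A> B \<in> hom (density \<A> B) (density \<A> (density \<A> B))"
  by (rule hom_densityI) (simp add: comult_def, simp add: comult_in hom_density_in)

theorem density_map_ident: "density_map \<A> B (ident B) = ident (density \<A> B)"
proof (rule density_ext)
  fix A f a assume *: "A \<in> \<A>" "f \<in> hom A B" "a \<in> univ A"
  have "comp_from A (ident B) f = f"
    using homD(1,3)[OF *(2)] by (auto simp: fun_eq_iff compose_def extensional_def)
  then show "density_map \<A> B (ident B) (A, f, a) = ident (density \<A> B) (A, f, a)"
    using * by (simp add: density_map_apply)
qed (simp_all add: density_map_def)

theorem density_map_compose:
  assumes "h \<in> hom B B'"
  shows "density_map \<A> B (comp_from B k h) =
    comp_from (density \<A> B) (density_map \<A> B' k) (density_map \<A> B h)"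
proof (rule density_ext)
  fix A f a assume *: "A \<in> \<A>" "f \<in> hom A B" "a \<in> univ A"
  have "comp_from A (comp_from B k h) f = comp_from A k (comp_from A h f)"
    using homD(1)[OF *(2)] by (auto simp: fun_eq_iff compose_def)
  then show "density_map \<A> B (comp_from B k h) (A, f, a) =
    comp_from (density \<A> B) (density_map \<A> B' k) (density_map \<A> B h) (A, f, a)"
    using * hom_compose[OF \<A>[OF *(1)] *(2) assms]
    by (simp add: density_map_apply compose_eq)
qed (simp_all add: density_map_def)

theorem counit_natural:
  assumes "h \<in> hom B B'"
  shows "comp_from (density \<A> B) (counit \<A> B') (density_map \<A> B h) =
    comp_from (density \<A> B) h (counit \<A> B)"
proof (rule density_ext)
  fix A f a assume *: "A \<in> \<A>" "f \<in> hom A B" "a \<in> univ A"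
  then show "comp_from (density \<A> B) (counit \<A> B') (density_map \<A> B h) (A, f, a) =
    comp_from (density \<A> B) h (counit \<A> B) (A, f, a)"
    using hom_compose[OF \<A>[OF *(1)] *(2) assms]
    by (simp add: density_map_apply counit_apply compose_eq)
qed simp_all

theorem comult_natural:
  assumes "h \<in> hom B B'"
  shows "comp_from (density \<A> B) (comult \<A> B') (density_map \<A> B h) =
    comp_from (density \<A> B) (density_map \<A> (density \<A> B) (density_map \<A> B h)) (comult \<A> B)"
proof (rule density_ext)
  fix A f a assume *: "A \<in> \<A>" "f \<in> hom A B" "a \<in> univ A"
  then show "comp_from (density \<A> B) (comult \<A> B') (density_map \<A> B h) (A, f, a) =
    comp_from (density \<A> B) (density_map \<A> (density \<A> B) (density_map \<A> B h)) (comult \<A> B) (A, f, a)"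
    using hom_compose[OF \<A>[OF *(1)] *(2) assms] hom_density_in[OF *(1,2)]
    by (simp add: density_map_apply comult_apply compose_eq density_map_in)
qed simp_all

theorem comult_counit_left:
  "comp_from (density \<A> B) (counit \<A> (density \<A> B)) (comult \<A> B) = ident (density \<A> B)"
proof (rule density_ext)
  fix A f a assume *: "A \<in> \<A>" "f \<in> hom A B" "a \<in> univ A"
  then show "comp_from (density \<A> B) (counit \<A> (density \<A> B)) (comult \<A> B) (A, f, a) =
    ident (density \<A> B) (A, f, a)"
    using hom_density_in[OF *(1,2)]
    by (simp add: comult_apply counit_apply compose_eq) (simp add: density_in_def)
qed simp_all

theorem comult_counit_right:
  "comp_from (density \<A> B) (density_map \<A> (density \<A> B) (counit \<A> B)) (comult \<A> B) =
    ident (density \<A> B)"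
proof (rule density_ext)
  fix A f a assume *: "A \<in> \<A>" "f \<in> hom A B" "a \<in> univ A"
  then show "comp_from (density \<A> B) (density_map \<A> (density \<A> B) (counit \<A> B)) (comult \<A> B) (A, f, a) =
    ident (density \<A> B) (A, f, a)"
    using hom_density_in[OF *(1,2)]
    by (simp add: comult_apply density_map_apply compose_eq counit_in)
qed simp_all

theorem comult_coassoc:
  "comp_from (density \<A> B) (comult \<A> (density \<A> B)) (comult \<A> B) =
    comp_from (density \<A> B) (density_map \<A> (density \<A> B) (comult \<A> B)) (comult \<A> B)"
proof (rule density_ext)
  fix A f a assume *: "A \<in> \<A>" "f \<in> hom A B" "a \<in> univ A"
  then show "comp_from (density \<A> B) (comult \<A> (density \<A> B)) (comult \<A> B) (A, f, a) =
    comp_from (density \<A> B) (density_map \<A> (density \<A> B) (comult \<A> B)) (comult \<A> B) (A, f, a)"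
    using hom_density_in[OF *(1,2)]
    by (simp add: comult_apply density_map_apply compose_eq comult_in)
qed simp_all

end

end

theory Submission
  imports Defs
begin

text \<open>
  The comultiplication law says that a coalgebra on \<open>X\<close> sending some point to \<open>(A, f, a)\<close> sends
  \<open>f b\<close> to \<open>(A, f, b)\<close> for every \<open>b\<close>.  So a coalgebra is a decomposition of \<open>X\<close> as a coproduct of
  copies of representatives \<open>A\<close>, embedded by the maps \<open>f\<close>; for finite \<open>X\<close> such a decomposition exists
  iff all connected components of \<open>X\<close> are in the class, iff \<open>X\<close> is.  By the same law a morphism of
  cofree coalgebras sends each summand \<open>A\<close> identically onto another copy of \<open>A\<close>, so it amounts to a
  family of maps \<open>hom A B \<rightarrow> hom A B'\<close> indexed by the representatives \<open>A\<close>, and an isomorphism to a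
  family of bijections.  Finally \<open>hom C B\<close> is the product of the sets \<open>hom A B\<close> over the summands \<open>A\<close>
  of \<open>C\<close>, so bijections for the representatives yield bijections for the whole class.
\<close>

section \<open>Isomorphisms\<close>

text \<open>Morphisms are extensional, so a map given by a formula has to be restricted. Tuples have
  their entries in the universe, hence the restriction acts on them as \<open>f\<close>
  does.\<close>

lemma hom_restrictI:
  assumes "\<And>x. x \<in> univ X \<Longrightarrow> f x \<in> univ Y"
    and "\<And>t R. t \<in> rel X R \<Longrightarrow> map f t \<in> rel Y R" and "is_object \<B> X"
  shows "restrict f (univ X) \<in> hom X Y"
proof -
  have "map (restrict f (univ X)) t = map f t" if "t \<in> rel X R" for t R
    using rel_subset_univ[OF assms(3) that] by auto
  then have "map (restrict f (univ X)) t \<in> rel Y R" if "t \<in> rel X R" for t R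
    using assms(2) that by metis
  then show ?thesis using assms(1) unfolding hom_def by simp
qed

lemma iso_objectsI:
  assumes "f \<in> hom X Y" "g \<in> hom Y X"
    and "\<And>x. x \<in> univ X \<Longrightarrow> g (f x) = x" "\<And>y. y \<in> univ Y \<Longrightarrow> f (g y) = y"
  shows "iso_objects X Y"
  using assms unfolding iso_objects_def by (intro bexI[of _ f] bexI[of _ g]) (auto simp: compose_def)

lemma iso_objectsE:
  assumes "iso_objects X Y"
  obtains f g where "f \<in> hom X Y" "g \<in> hom Y X"
    "\<And>x. x \<in> univ X \<Longrightarrow> g (f x) = x" "\<And>y. y \<in> univ Y \<Longrightarrow> f (g y) = y"
  using assms unfolding iso_objects_def by (metis compose_eq restrict_apply')

lemma iso_objects_trans:
  assumes "is_object \<B> X" "is_object \<B> Z" "iso_objects X Y" "iso_objects Y Z"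
  shows "iso_objects X Z"
proof -
  obtain f g where fg: "f \<in> hom X Y" "g \<in> hom Y X"
    "\<And>x. x \<in> univ X \<Longrightarrow> g (f x) = x" "\<And>y. y \<in> univ Y \<Longrightarrow> f (g y) = y"
    by (rule iso_objectsE[OF assms(3)]) blast
  obtain h k where hk: "h \<in> hom Y Z" "k \<in> hom Z Y"
    "\<And>y. y \<in> univ Y \<Longrightarrow> k (h y) = y" "\<And>z. z \<in> univ Z \<Longrightarrow> h (k z) = z"
    by (rule iso_objectsE[OF assms(4)]) blast
  show ?thesis
    by (rule iso_objectsI[OF hom_compose[OF assms(1) fg(1) hk(1)] hom_compose[OF assms(2) hk(2) fg(2)]])
      (use fg hk homD(1)[OF fg(1)] homD(1)[OF hk(2)] in \<open>simp_all add: compose_def homD(1)[OF fg(2)] homD(1)[OF hk(1)]\<close>)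
qed

text \<open>Precomposition with the two inverse isomorphisms gives inverse bijections. It bridges
  the types of \<open>\<A>\<close> and \<open>\<Delta>\<close>: a representative is only isomorphic
  to a member of the class.\<close>

lemma iso_objects_hom_eqpoll:
  assumes "is_object \<B> C" "is_object \<B> D" "iso_objects C D"
  shows "hom C X \<approx> hom D X"
proof -
  obtain f g where fg: "f \<in> hom C D" "g \<in> hom D C"
    "\<And>x. x \<in> univ C \<Longrightarrow> g (f x) = x" "\<And>y. y \<in> univ D \<Longrightarrow> f (g y) = y"
    by (rule iso_objectsE[OF assms(3)]) blast
  have "bij_betw (\<lambda>u. comp_from D u g) (hom C X) (hom D X)"
  proof (rule bij_betw_byWitness[where f' = "\<lambda>v. comp_from C v f"])
    show "\<forall>u\<in>hom C X. comp_from C (comp_from D u g) f = u"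
      using fg(3) homD(1)[OF fg(1)] by (auto simp: compose_def intro!: extensionalityI[OF _ homD(3)])
    show "\<forall>v\<in>hom D X. comp_from D (comp_from C v f) g = v"
      using fg(4) homD(1)[OF fg(2)] by (auto simp: compose_def intro!: extensionalityI[OF _ homD(3)])
    show "(\<lambda>u. comp_from D u g) ` hom C X \<subseteq> hom D X"
      using hom_compose[OF assms(2) fg(2)] by blast
    show "(\<lambda>v. comp_from C v f) ` hom D X \<subseteq> hom C X"
      using hom_compose[OF assms(1) fg(1)] by blast
  qed
  then show ?thesis by (auto simp: eqpoll_def)
qed

text \<open>By Schroeder-Bernstein it suffices to embed each product factorwise into the
  other.\<close>

lemma eqpoll_PiE:
  assumes "\<And>i. i \<in> I \<Longrightarrow> F i \<approx> G i"
  shows "PiE I F \<approx> PiE I G"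
  by (intro lepoll_antisym lepoll_PiE) (use assms in \<open>auto intro: eqpoll_imp_lepoll eqpoll_sym\<close>)

section \<open>Coalgebras and cofree coalgebras\<close>

text \<open>At a point \<open>x\<close> the counit law reads \<open>f a = x\<close>. The
  comultiplication law compares \<open>(A, density_in A f, a)\<close> with
  \<open>(A, comp_from A \<alpha> f, a)\<close>, so it says that \<alpha> composed with
  \<open>f\<close> is the inclusion of the summand of \<open>f\<close>.\<close>

lemma coalgebra_iff:
  "coalgebra \<A> X \<alpha> \<longleftrightarrow> \<alpha> \<in> hom X (density \<A> X) \<and>
     (\<forall>x\<in>univ X. \<forall>A f a. \<alpha> x = (A, f, a) \<longrightarrow>
        f a = x \<and> (\<forall>b\<in>univ A. \<alpha> (f b) = (A, f, b)))"
proof -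
  have *: "(comp_from X (counit \<A> X) \<alpha> = ident X \<and>
      comp_from X (comult \<A> X) \<alpha> = comp_from X (density_map \<A> X \<alpha>) \<alpha>) \<longleftrightarrow>
      (\<forall>x\<in>univ X. \<forall>A f a. \<alpha> x = (A, f, a) \<longrightarrow>
        f a = x \<and> (\<forall>b\<in>univ A. \<alpha> (f b) = (A, f, b)))" (is "?l \<longleftrightarrow> ?r")
    if \<alpha>: "\<alpha> \<in> hom X (density \<A> X)"
  proof -
    have "?l \<longleftrightarrow> (\<forall>x\<in>univ X. counit \<A> X (\<alpha> x) = x \<and>
        comult \<A> X (\<alpha> x) = density_map \<A> X \<alpha> (\<alpha> x))"
      by (auto simp: compose_def fun_eq_iff restrict_def)
    also have "\<dots> \<longleftrightarrow> ?r"
    proof (intro ball_cong refl)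
      fix x assume "x \<in> univ X"
      obtain A f a where x: "\<alpha> x = (A, f, a)" by (rule prod_cases3)
      then have mem: "(A, f, a) \<in> univ (density \<A> X)"
        using homD(1)[OF \<alpha> \<open>x \<in> univ X\<close>] by simp
      then have a: "a \<in> univ A" by simp
      have "counit \<A> X (\<alpha> x) = f a"
        using mem by (simp add: counit_def x del: univ_density)
      moreover have "comult \<A> X (\<alpha> x) = (A, density_in A f, a)"
        using mem a by (simp add: comult_def x density_in_def[of A "density_in A f"] del: univ_density)
      moreover have "density_map \<A> X \<alpha> (\<alpha> x) = (A, comp_from A \<alpha> f, a)"
        using mem a by (simp add: density_map_def x density_in_def del: univ_density)
      moreover have "density_in A f = comp_from A \<alpha> f \<longleftrightarrow> (\<forall>b\<in>univ A. \<alpha> (f b) = (A, f, b))"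
        by (auto simp: density_in_def compose_def fun_eq_iff restrict_def)
      ultimately show "(counit \<A> X (\<alpha> x) = x \<and> comult \<A> X (\<alpha> x) = density_map \<A> X \<alpha> (\<alpha> x)) \<longleftrightarrow>
        (\<forall>A f a. \<alpha> x = (A, f, a) \<longrightarrow> f a = x \<and> (\<forall>b\<in>univ A. \<alpha> (f b) = (A, f, b)))"
        using x by auto
    qed
    finally show ?thesis .
  qed
  then show ?thesis unfolding coalgebra_def by blast
qed

section \<open>Morphisms of cofree coalgebras as families of functions between hom-sets\<close>

text \<open>Comultiplication keeps the representative and the point of a triple, so a map
  \<open>h\<close> commuting with it keeps them too. Only the middle entry can change, and the
  counit reads off the new one.\<close>

lemma hom_cofreeD:
  assumes h: "h \<in> coalgebra_hom \<A> (cofree \<A> B) (cofree \<A> B')"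
    and D: "D \<in> \<A>" "f \<in> hom D B" and obj: "\<And>A. A \<in> \<A> \<Longrightarrow> is_object \<B> A"
  defines "g \<equiv> comp_from D (counit \<A> B') (comp_from D h (density_in D f))"
  shows "g \<in> hom D B'" "a \<in> univ D \<Longrightarrow> h (D, f, a) = (D, g, a)"
proof -
  have hh: "h \<in> hom (density \<A> B) (density \<A> B')"
    and comm: "comp_from (density \<A> B) (comult \<A> B') h =
      comp_from (density \<A> B) (density_map \<A> (density \<A> B) h) (comult \<A> B)"
    using h by (auto simp: coalgebra_hom_def cofree_def)
  have inD: "density_in D f \<in> hom D (density \<A> B)"
    by (rule hom_density_in[OF obj D])
  then have "comp_from D h (density_in D f) \<in> hom D (density \<A> B')"
    using hh by (rule hom_compose[OF obj[OF D(1)]])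
  then show "g \<in> hom D B'"
    unfolding g_def by (rule hom_compose[OF obj[OF D(1)] _ hom_counit[OF obj]])
  assume a: "a \<in> univ D"
  have mem: "(D, f, a) \<in> univ (density \<A> B)" using D a by simp
  obtain D' g' a' where e: "h (D, f, a) = (D', g', a')" by (rule prod_cases3)
  have mem': "(D', g', a') \<in> univ (density \<A> B')" using homD(1)[OF hh mem] e by simp
  have "comult \<A> B' (h (D, f, a)) = density_map \<A> (density \<A> B) h (comult \<A> B (D, f, a))"
    using fun_cong[OF comm, of "(D, f, a)"] mem by (simp add: compose_def del: univ_density)
  moreover have "comult \<A> B' (h (D, f, a)) = (D', density_in D' g', a')"
    using mem' by (simp add: e comult_apply[OF obj])
  moreover have "comult \<A> B (D, f, a) = (D, density_in D f, a)"
    using D a by (simp add: comult_apply[OF obj])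
  moreover have "density_map \<A> (density \<A> B) h (D, density_in D f, a) =
      (D, comp_from D h (density_in D f), a)"
    using D a inD by (simp add: density_map_apply[OF obj])
  \<comment> \<open>The two sides of the morphism law are equated entry by entry. The middle entries
    show that \<open>h\<close> carries the inclusion of the summand of \<open>f\<close> to that of
    \<open>g'\<close>.\<close>
  ultimately have eq: "D' = D" "a' = a" "comp_from D h (density_in D f) = density_in D g'" by auto
  have "g = g'"
    unfolding g_def eq(3) using mem' eq(1) by (simp add: counit_in[OF obj])
  then show "h (D, f, a) = (D, g, a)" using e eq by simp
qed

text \<open>By \<open>hom_cofreeD\<close>, \<open>h\<close> and \<open>k\<close> induce functions
  between the two hom-sets. Comparing triples at each point of \<open>D\<close> shows that these are
  mutually inverse.\<close>

lemma cofree_iso_imp_hom_eqpoll: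
  assumes iso: "coalgebra_iso \<A> (cofree \<A> B) (cofree \<A> B')"
    and D: "D \<in> \<A>" and obj: "\<And>A. A \<in> \<A> \<Longrightarrow> is_object \<B> A"
  shows "hom D B \<approx> hom D B'"
proof -
  obtain h k where h: "h \<in> coalgebra_hom \<A> (cofree \<A> B) (cofree \<A> B')"
    and k: "k \<in> coalgebra_hom \<A> (cofree \<A> B') (cofree \<A> B)"
    and kh: "comp_from (density \<A> B) k h = ident (density \<A> B)"
    and hk: "comp_from (density \<A> B') h k = ident (density \<A> B')"
    using iso by (auto simp: coalgebra_iso_def cofree_def)
  define \<phi> where "\<phi> f = comp_from D (counit \<A> B') (comp_from D h (density_in D f))" for f
  define \<psi> where "\<psi> g = comp_from D (counit \<A> B) (comp_from D k (density_in D g))" for g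
  have \<phi>: "\<phi> f \<in> hom D B'" "a \<in> univ D \<Longrightarrow> h (D, f, a) = (D, \<phi> f, a)" if "f \<in> hom D B" for f a
    unfolding \<phi>_def using hom_cofreeD[OF h D that obj] by auto
  have \<psi>: "\<psi> g \<in> hom D B" "a \<in> univ D \<Longrightarrow> k (D, g, a) = (D, \<psi> g, a)" if "g \<in> hom D B'" for g a
    unfolding \<psi>_def using hom_cofreeD[OF k D that obj] by auto
  have "\<psi> (\<phi> f) = f" if f: "f \<in> hom D B" for f
  proof (rule extensionalityI[OF homD(3)[OF \<psi>(1)[OF \<phi>(1)[OF f]]] homD(3)[OF f]])
    fix a assume a: "a \<in> univ D"
    have "k (h (D, f, a)) = (D, f, a)"
      using fun_cong[OF kh, of "(D, f, a)"] D f a by (simp add: compose_def)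
    then show "\<psi> (\<phi> f) a = f a" using \<phi>[OF f] \<psi>(2)[OF \<phi>(1)[OF f]] a by simp
  qed
  moreover have "\<phi> (\<psi> g) = g" if g: "g \<in> hom D B'" for g
  proof (rule extensionalityI[OF homD(3)[OF \<phi>(1)[OF \<psi>(1)[OF g]]] homD(3)[OF g]])
    fix a assume a: "a \<in> univ D"
    have "h (k (D, g, a)) = (D, g, a)"
      using fun_cong[OF hk, of "(D, g, a)"] D g a by (simp add: compose_def)
    then show "\<phi> (\<psi> g) a = g a" using \<psi>[OF g] \<phi>(2)[OF \<psi>(1)[OF g]] a by simp
  qed
  ultimately have "bij_betw \<phi> (hom D B) (hom D B')"
    using \<phi>(1) \<psi>(1) by (intro bij_betw_byWitness[where f' = \<psi>]) auto
  then show ?thesis by (auto simp: eqpoll_def)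
qed

text \<open>Converse of \<open>hom_cofreeD\<close>. The representatives form a discrete category, so
  no naturality in \<open>D\<close> is asked of \<open>\<phi>\<close>. The fact \<open>hin\<close>,
  that summand inclusions go to summand inclusions, yields both preservation of relations and the
  coalgebra law.\<close>

lemma cofree_homI:
  assumes \<phi>: "\<And>D f. D \<in> \<A> \<Longrightarrow> f \<in> hom D B \<Longrightarrow> \<phi> D f \<in> hom D B'"
    and obj: "\<And>A. A \<in> \<A> \<Longrightarrow> is_object \<B> A"
  shows "(\<lambda>(D, f, a)\<in>univ (density \<A> B). (D, \<phi> D f, a)) \<in>
    coalgebra_hom \<A> (cofree \<A> B) (cofree \<A> B')"
proof -
  define h where "h = (\<lambda>(D, f, a)\<in>univ (density \<A> B). (D, \<phi> D f, a))"
  have hin: "comp_from D h (density_in D f) = density_in D (\<phi> D f)"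
    if "D \<in> \<A>" "f \<in> hom D B" for D f
    using that by (auto simp: h_def compose_def density_in_def fun_eq_iff)
  have hh: "h \<in> hom (density \<A> B) (density \<A> B')"
    by (rule hom_densityI[OF obj]) (simp_all add: hin hom_density_in[OF obj] \<phi>, simp add: h_def)
  have "comp_from (density \<A> B) (comult \<A> B') h =
      comp_from (density \<A> B) (density_map \<A> (density \<A> B) h) (comult \<A> B)"
  proof (rule density_ext[OF obj])
    fix D f a assume *: "D \<in> \<A>" "f \<in> hom D B" "a \<in> univ D"
    have "h (D, f, a) = (D, \<phi> D f, a)" using * by (simp add: h_def)
    then show "comp_from (density \<A> B) (comult \<A> B') h (D, f, a) =
        comp_from (density \<A> B) (density_map \<A> (density \<A> B) h) (comult \<A> B) (D, f, a)"
      using * \<phi>[OF *(1,2)] hom_density_in[OF obj *(1,2)]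
      by (simp add: compose_eq comult_apply[OF obj] density_map_apply[OF obj] hin)
  qed simp_all
  then show ?thesis unfolding h_def[symmetric] using hh by (simp add: coalgebra_hom_def cofree_def)
qed

lemma hom_eqpoll_imp_cofree_iso:
  assumes eq: "\<And>D. D \<in> \<A> \<Longrightarrow> hom D B \<approx> hom D B'"
    and obj: "\<And>A. A \<in> \<A> \<Longrightarrow> is_object \<B> A"
  shows "coalgebra_iso \<A> (cofree \<A> B) (cofree \<A> B')"
proof -
  have "\<forall>D. \<exists>\<phi>. D \<in> \<A> \<longrightarrow> bij_betw \<phi> (hom D B) (hom D B')"
    using eq by (auto simp: eqpoll_def)
  then obtain \<phi> where \<phi>: "\<And>D. D \<in> \<A> \<Longrightarrow> bij_betw (\<phi> D) (hom D B) (hom D B')" by metis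
  define \<psi> where "\<psi> D = inv_into (hom D B) (\<phi> D)" for D
  have \<phi>1: "\<phi> D f \<in> hom D B'" "\<psi> D (\<phi> D f) = f" if "D \<in> \<A>" "f \<in> hom D B" for D f
    using \<phi>[OF that(1)] that(2) by (auto simp: \<psi>_def bij_betw_apply bij_betw_inv_into_left)
  have \<psi>1: "\<psi> D g \<in> hom D B" "\<phi> D (\<psi> D g) = g" if "D \<in> \<A>" "g \<in> hom D B'" for D g
    using \<phi>[OF that(1)] that(2) bij_betw_apply[OF bij_betw_inv_into[OF \<phi>[OF that(1)]] that(2)]
    by (simp_all add: \<psi>_def bij_betw_inv_into_right)
  let ?h = "\<lambda>(D, f, a)\<in>univ (density \<A> B). (D, \<phi> D f, a)"
  let ?k = "\<lambda>(D, g, a)\<in>univ (density \<A> B'). (D, \<psi> D g, a)"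
  have "?h \<in> coalgebra_hom \<A> (cofree \<A> B) (cofree \<A> B')"
    using \<phi>1(1) obj by (rule cofree_homI)
  moreover have "?k \<in> coalgebra_hom \<A> (cofree \<A> B') (cofree \<A> B)"
    using \<psi>1(1) obj by (rule cofree_homI)
  moreover have "comp_from (density \<A> B) ?k ?h = ident (density \<A> B)"
  proof (rule density_ext[OF obj, where B = B])
    fix D f a assume "D \<in> \<A>" "f \<in> hom D B" "a \<in> univ D"
    then show "comp_from (density \<A> B) ?k ?h (D, f, a) = ident (density \<A> B) (D, f, a)"
      using \<phi>1[of D f] by (simp add: compose_eq)
  qed simp_all
  moreover have "comp_from (density \<A> B') ?h ?k = ident (density \<A> B')"
  proof (rule density_ext[OF obj, where B = B'])
    fix D f a assume "D \<in> \<A>" "f \<in> hom D B'" "a \<in> univ D"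
    then show "comp_from (density \<A> B') ?h ?k (D, f, a) = ident (density \<A> B') (D, f, a)"
      using \<psi>1[of D f] by (simp add: compose_eq)
  qed simp_all
  ultimately show ?thesis unfolding coalgebra_iso_def cofree_def fst_conv by blast
qed


section \<open>Transport of coalgebra structures along isomorphisms\<close>

text \<open>Coalgebras are first built on members of \<open>\<Delta>\<close>, which live over
  \<open>nat\<close>; conjugating by an isomorphism moves them to objects over any type.\<close>

lemma coalgebra_transport:
  assumes \<alpha>: "coalgebra \<A> Y \<alpha>" and iso: "iso_objects X Y" and X: "is_object \<B> X"
    and obj: "\<And>A. A \<in> \<A> \<Longrightarrow> is_object \<B> A"
  shows "\<exists>\<beta>. coalgebra \<A> X \<beta>"
proof -
  obtain k h where k: "k \<in> hom X Y" and h: "h \<in> hom Y X"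
    and hk: "\<And>x. x \<in> univ X \<Longrightarrow> h (k x) = x" and kh: "\<And>y. y \<in> univ Y \<Longrightarrow> k (h y) = y"
    using iso by (rule iso_objectsE) blast
  define \<beta> where "\<beta> = comp_from X (density_map \<A> Y h) (comp_from X \<alpha> k)"
  have \<alpha>h: "\<alpha> \<in> hom Y (density \<A> Y)" using \<alpha> by (simp add: coalgebra_def)
  have \<beta>h: "\<beta> \<in> hom X (density \<A> X)"
    unfolding \<beta>_def using hom_compose[OF X k \<alpha>h] hom_density_map[OF obj h] by (rule hom_compose[OF X])
  moreover have "g a = x \<and> (\<forall>b\<in>univ A. \<beta> (g b) = (A, g, b))"
    if x: "x \<in> univ X" and e: "\<beta> x = (A, g, a)" for x A g a
  proof -
    have kx: "k x \<in> univ Y" using homD(1)[OF k x] .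
    obtain A' f a' where e': "\<alpha> (k x) = (A', f, a')" by (rule prod_cases3)
    have mem: "A' \<in> \<A>" "f \<in> hom A' Y" "a' \<in> univ A'" using homD(1)[OF \<alpha>h kx] e' by simp_all
    then have "\<beta> x = (A', comp_from A' h f, a')"
      using x by (simp add: \<beta>_def compose_eq e' density_map_apply[OF obj])
    then have eqs: "A = A'" "g = comp_from A' h f" "a = a'" using e by auto
    have f: "f a' = k x" "\<And>b. b \<in> univ A' \<Longrightarrow> \<alpha> (f b) = (A', f, b)"
      using \<alpha> kx e' unfolding coalgebra_iff by blast+
    have "\<beta> (g b) = (A, g, b)" if b: "b \<in> univ A'" for b
    proof -
      have fb: "f b \<in> univ Y" using homD(1)[OF mem(2) b] .
      \<comment> \<open>Since \<open>k\<close> undoes the \<open>h\<close> inside \<open>g\<close>,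
        the value of \<beta> at \<open>g b\<close> is computed from \<alpha> at \<open>f b\<close>,
        where the law for \<alpha> applies.\<close>
      then have "k (g b) = f b" "g b \<in> univ X" using b kh homD(1)[OF h] by (simp_all add: eqs compose_eq)
      then show ?thesis using mem b f(2)[OF b]
        by (simp add: \<beta>_def compose_eq density_map_apply[OF obj]) (simp add: eqs)
    qed
    then show ?thesis using f(1) hk[OF x] mem(3) eqs by (simp add: compose_eq)
  qed
  ultimately show ?thesis unfolding coalgebra_iff by blast
qed

section \<open>Decomposition into connected components\<close>

definition induced :: "('a, 's) rel_structure \<Rightarrow> 'a set \<Rightarrow> ('a, 's) rel_structure" where
  "induced X S = \<lparr>univ = univ X \<inter> S, rel = (\<lambda>R. {t \<in> rel X R. set t \<subseteq> S})\<rparr>"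

lemma univ_induced [simp]: "univ (induced X S) = univ X \<inter> S"
  and rel_induced [simp]: "rel (induced X S) R = {t \<in> rel X R. set t \<subseteq> S}"
  by (simp_all add: induced_def)

lemma is_object_induced: "is_object \<B> X \<Longrightarrow> is_object \<B> (induced X S)"
  unfolding induced_def by (rule is_object_restrict)

definition component :: "('a, 's) rel_structure \<Rightarrow> 'a \<Rightarrow> 'a set" where
  "component X x = {y. (x, y) \<in> (gaifman X)\<^sup>*}"

lemma component_self [simp]: "x \<in> component X x"
  by (simp add: component_def)

text \<open>The Gaifman graph is symmetric, so reachability is an equivalence relation and
  components are its classes.\<close>

lemma component_eq: "y \<in> component X x \<Longrightarrow> component X y = component X x"
proof -
  assume "y \<in> component X x"
  then have "(x, y) \<in> (gaifman X)\<^sup>*" by (simp add: component_def)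
  moreover from this have "(y, x) \<in> (gaifman X)\<^sup>*"
    by (rule symD[OF sym_rtrancl, rotated]) (auto simp: sym_def gaifman_def)
  ultimately show ?thesis by (auto simp: component_def)
qed

text \<open>Two entries of one tuple are equal or adjacent in the Gaifman graph.\<close>

lemma rel_subset_component: "t \<in> rel X R \<Longrightarrow> x \<in> set t \<Longrightarrow> set t \<subseteq> component X x"
  by (auto simp: component_def gaifman_def)

lemma rel_component_cases:
  "t \<in> rel X R \<Longrightarrow> set t \<subseteq> component X x \<or> set t \<subseteq> - component X x"
proof (rule disjCI)
  assume t: "t \<in> rel X R" and "\<not> set t \<subseteq> - component X x"
  then obtain y where y: "y \<in> set t" "y \<in> component X x" by blast
  show "set t \<subseteq> component X x"
    using rel_subset_component[OF t y(1)] unfolding component_eq[OF y(2)] .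
qed

text \<open>A path starting in the component never leaves it, and each of its edges comes from a
  tuple lying wholly inside, so the path survives in the induced substructure.\<close>

lemma connected_component:
  assumes "x \<in> univ X"
  shows "connected_object (induced X (component X x))"
proof -
  have "(y, z) \<in> (gaifman (induced X (component X x)))\<^sup>* "
    if "(y, z) \<in> (gaifman X)\<^sup>*" "y \<in> component X x" for y z
    using that
  proof induction
    case (step z w)
    have z: "z \<in> component X x"
      using step.hyps(1) component_eq[OF step.prems] by (auto simp: component_def)
    obtain R t where t: "t \<in> rel X R" "z \<in> set t" "w \<in> set t" "z \<noteq> w"
      using step.hyps(2) by (auto simp: gaifman_def)
    have "set t \<subseteq> component X x" using rel_subset_component[OF t(1,2)] component_eq[OF z] by simp
    then have "t \<in> rel (induced X (component X x)) R" using t by simp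
    then have "(z, w) \<in> gaifman (induced X (component X x))" using t unfolding gaifman_def by blast
    then show ?case using step by (meson rtrancl.rtrancl_into_rtrancl)
  qed simp
  moreover have "(y, z) \<in> (gaifman X)\<^sup>*" if "y \<in> component X x" "z \<in> component X x" for y z
    using that component_eq[OF that(1)] by (auto simp: component_def)
  ultimately show ?thesis using assms by (auto simp: connected_object_def)
qed

text \<open>No tuple crosses between \<open>S\<close> and its complement, so the two induced
  substructures carry all relations. The coproduct over \<open>bool\<close> matches the form of
  closure under summands in \<open>component_based\<close>.\<close>

lemma iso_coprod_induced:
  assumes X: "is_object \<B> X" and S: "\<And>t R. t \<in> rel X R \<Longrightarrow> set t \<subseteq> S \<or> set t \<subseteq> - S"
  shows "iso_objects (coprod UNIV (\<lambda>b. if b then induced X S else induced X (- S))) X"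
proof -
  define A where "A = (\<lambda>b. if b then induced X S else induced X (- S))"
  have A: "is_object \<B> (coprod UNIV A)"
    by (rule is_object_coprod) (simp add: A_def is_object_induced[OF X])
  have "restrict snd (univ (coprod UNIV A)) \<in> hom (coprod UNIV A) X"
  proof (rule hom_restrictI[OF _ _ A])
    fix t R assume "t \<in> rel (coprod UNIV A) R"
    then obtain b s where "s \<in> rel (A b) R" "t = map (Pair b) s" by (auto simp: coprod_def)
    then show "map snd t \<in> rel X R" by (auto simp: A_def comp_def split: if_splits)
  qed (auto simp: coprod_def A_def split: if_splits)
  moreover have "(\<lambda>z\<in>univ X. (z \<in> S, z)) \<in> hom X (coprod UNIV A)"
  proof (rule hom_restrictI[OF _ _ X])
    fix t R assume t: "t \<in> rel X R"
    obtain b where b: "\<forall>z\<in>set t. (z \<in> S) = b" using S[OF t] by blast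
    then have "map (\<lambda>z. (z \<in> S, z)) t = map (Pair b) t" by simp
    moreover have "t \<in> rel (A b) R" using t b by (cases b) (auto simp: A_def)
    ultimately show "map (\<lambda>z. (z \<in> S, z)) t \<in> rel (coprod UNIV A) R"
      unfolding coprod_def rel_structure.simps by (intro UN_I[OF UNIV_I] image_eqI)
  qed (auto simp: coprod_def A_def)
  ultimately show ?thesis unfolding A_def[symmetric]
    by (rule iso_objectsI) (auto simp: coprod_def A_def split: if_splits)
qed

section \<open>Closure properties of a component-based class\<close>

lemma component_basedD:
  assumes "component_based \<B> \<Delta>" "Y \<in> \<Delta>"
  shows "is_object \<B> Y"
proof -
  have "\<forall>A\<in>\<Delta>. finite_object \<B> A"
    using assms(1) unfolding component_based_def by (elim conjE)
  then show ?thesis using assms(2) by (simp add: finite_object_def)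
qed

lemma component_based_coprod:
  fixes I :: "nat set"
  assumes "component_based \<B> \<Delta>" "finite I" "\<And>i. i \<in> I \<Longrightarrow> A i \<in> \<Delta>"
  shows "in_class \<Delta> (coprod I A)"
proof -
  have "\<forall>(I :: nat set) A. finite I \<and> (\<forall>i\<in>I. A i \<in> \<Delta>) \<longrightarrow> in_class \<Delta> (coprod I A)"
    using assms(1) unfolding component_based_def by (elim conjE)
  then show ?thesis using assms(2,3) by blast
qed

lemma component_based_summand:
  assumes "component_based \<B> \<Delta>" "is_object \<B> A" "is_object \<B> B"
    and "in_class \<Delta> (coprod UNIV (\<lambda>b. if b then A else B))"
  shows "A \<in> \<Delta>"
proof -
  have "\<forall>A B. is_object \<B> A \<and> is_object \<B> B \<and>
      in_class \<Delta> (coprod (UNIV :: bool set) (\<lambda>b. if b then A else B)) \<longrightarrow> A \<in> \<Delta> \<and> B \<in> \<Delta>"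
    using assms(1) unfolding component_based_def by (elim conjE)
  then show ?thesis using assms(2-4) by blast
qed

text \<open>Splitting off the component exhibits it as a summand of \<open>Y\<close>.\<close>

lemma component_in_class:
  assumes \<Delta>: "component_based \<B> \<Delta>" and Y: "Y \<in> \<Delta>"
  shows "induced Y (component Y y) \<in> \<Delta>"
proof -
  let ?A = "induced Y (component Y y)" and ?B = "induced Y (- component Y y)"
  have obj: "is_object \<B> Y" using component_basedD[OF \<Delta> Y] .
  then have "iso_objects (coprod UNIV (\<lambda>b. if b then ?A else ?B)) Y"
    by (rule iso_coprod_induced) (rule rel_component_cases)
  then have "in_class \<Delta> (coprod UNIV (\<lambda>b. if b then ?A else ?B))"
    unfolding in_class_def using Y by (rule bexI)
  then show ?thesis
    by (rule component_based_summand[OF \<Delta> is_object_induced[OF obj] is_object_induced[OF obj]])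
qed

section \<open>Coalgebra structures on members of the class\<close>

text \<open>Each component is in the class and connected, hence isomorphic to a representative by
  some \<open>p\<close> with inverse \<open>q\<close>. A point \<open>y\<close> goes to its
  \<open>p\<close>-image, in the summand indexed by \<open>q\<close> viewed as a map into
  \<open>Y\<close>.\<close>

lemma coalgebra_if_member:
  assumes base: "(\<exists>\<sigma>. relational_signature \<sigma> \<and> \<B> = Rel_Structures \<sigma>) \<or> (\<exists>E. \<B> = Graphs E)"
    and \<Delta>: "component_based \<B> \<Delta>" and \<A>: "connected_representatives \<B> \<Delta> \<A>" and Y: "Y \<in> \<Delta>"
  shows "\<exists>\<alpha>. coalgebra \<A> Y \<alpha>"
proof -
  define K where "K y = induced Y (component Y y)" for y
  have obj: "is_object \<B> Y" using component_basedD[OF \<Delta> Y] .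
  have "\<forall>y\<in>univ Y. \<exists>D p q. D \<in> \<A> \<and> p \<in> hom (K y) D \<and> q \<in> hom D (K y) \<and>
      (\<forall>x\<in>univ (K y). q (p x) = x) \<and> (\<forall>a\<in>univ D. p (q a) = a)"
  proof
    fix y assume "y \<in> univ Y"
    then have "K y \<in> \<Delta>" "connected_object (K y)"
      unfolding K_def by (intro component_in_class[OF \<Delta> Y] connected_component)+
    then obtain D where "D \<in> \<A>" "iso_objects (K y) D"
      using \<A> unfolding connected_representatives_def by blast
    then show "\<exists>D p q. D \<in> \<A> \<and> p \<in> hom (K y) D \<and> q \<in> hom D (K y) \<and>
        (\<forall>x\<in>univ (K y). q (p x) = x) \<and> (\<forall>a\<in>univ D. p (q a) = a)"
      by (elim iso_objectsE) blast
  qed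
  then obtain D p q where D: "\<And>y. y \<in> univ Y \<Longrightarrow> D y \<in> \<A>"
    and p: "\<And>y. y \<in> univ Y \<Longrightarrow> p y \<in> hom (K y) (D y)"
    and q: "\<And>y. y \<in> univ Y \<Longrightarrow> q y \<in> hom (D y) (K y)"
    and qp: "\<And>y x. y \<in> univ Y \<Longrightarrow> x \<in> univ (K y) \<Longrightarrow> q y (p y x) = x"
    and pq: "\<And>y a. y \<in> univ Y \<Longrightarrow> a \<in> univ (D y) \<Longrightarrow> p y (q y a) = a"
    unfolding bchoice_iff by blast
  \<comment> \<open>\<open>D\<close>, \<open>p\<close>, \<open>q\<close> were chosen pointwise; \<open>r\<close> makes the choice depend only on the component.\<close>
  define r where "r y = (SOME x. x \<in> univ Y \<and> component Y x = component Y y)" for y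
  have r: "r y \<in> univ Y" "component Y (r y) = component Y y" "K (r y) = K y" if "y \<in> univ Y" for y
    using someI[of "\<lambda>x. x \<in> univ Y \<and> component Y x = component Y y" y] that
    by (auto simp: r_def K_def)
  have rK: "r x = r y" if "x \<in> component Y y" for x y
    using component_eq[OF that] by (simp add: r_def)
  have qY: "q y \<in> hom (D y) Y" if "y \<in> univ Y" for y
    using q[OF that] by (auto simp: hom_def K_def PiE_def)
  define \<alpha> where "\<alpha> = (\<lambda>y\<in>univ Y. (D (r y), q (r y), p (r y) y))"
  have "\<alpha> \<in> hom Y (density \<A> Y)"
    unfolding \<alpha>_def
  proof (rule hom_restrictI[OF _ _ obj])
    fix y assume y: "y \<in> univ Y"
    have "y \<in> univ (K (r y))" using r[OF y] y by (simp add: K_def)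
    then show "(D (r y), q (r y), p (r y) y) \<in> univ (density \<A> Y)"
      using D qY homD(1)[OF p] r(1)[OF y] by simp
  next
    fix t R assume t: "t \<in> rel Y R"
    \<comment> \<open>Arities are positive, so \<open>t\<close> has an entry, which determines the
      component containing all of \<open>t\<close>.\<close>
    then obtain y where y: "y \<in> set t" using rel_not_Nil[OF base obj, of R] by (cases t) auto
    then have yY: "y \<in> univ Y" using rel_subset_univ[OF obj t] by blast
    have ts: "set t \<subseteq> component Y y" using rel_subset_component[OF t y] .
    then have "t \<in> rel (K (r y)) R" using t r[OF yY] by (simp add: K_def)
    then have "map (p (r y)) t \<in> rel (D (r y)) R" using homD(2)[OF p] r(1)[OF yY] by blast
    moreover have "map (\<lambda>y. (D (r y), q (r y), p (r y) y)) t =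
        map (\<lambda>a. (D (r y), q (r y), a)) (map (p (r y)) t)"
      using ts rK by auto
    ultimately show "map (\<lambda>y. (D (r y), q (r y), p (r y) y)) t \<in> rel (density \<A> Y) R"
      unfolding rel_density using D qY r(1)[OF yY] by blast
  qed
  moreover have "f a = y \<and> (\<forall>b\<in>univ A. \<alpha> (f b) = (A, f, b))"
    if y: "y \<in> univ Y" and e: "\<alpha> y = (A, f, a)" for y A f a
  proof -
    have eqs: "A = D (r y)" "f = q (r y)" "a = p (r y) y" using y e by (auto simp: \<alpha>_def)
    have "y \<in> univ (K (r y))" using r[OF y] y by (simp add: K_def)
    then have "f a = y" using qp[OF r(1)[OF y]] by (simp add: eqs)
    moreover have "\<alpha> (f b) = (A, f, b)" if b: "b \<in> univ A" for b
    proof -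
      \<comment> \<open>The point \<open>f b\<close> stays in the component of \<open>y\<close>, so
        \<open>r\<close> makes the same choice for both.\<close>
      have "f b \<in> univ (K y)" using homD(1)[OF q[OF r(1)[OF y]]] b r(3)[OF y] by (simp add: eqs)
      then have "f b \<in> univ Y" "r (f b) = r y" using rK by (auto simp: K_def)
      then show ?thesis using pq[OF r(1)[OF y]] b by (simp add: \<alpha>_def eqs)
    qed
    ultimately show ?thesis by blast
  qed
  ultimately show ?thesis unfolding coalgebra_iff by blast
qed

section \<open>Decomposition of a coalgebra into summands\<close>

text \<open>For a coalgebra, all points in the image of one copy of \<open>D\<close> yield the same
  pair, so the pairs index the copies rather than the points.\<close>

definition summands ::
  "('x, 's) rel_structure \<Rightarrow> ('x \<Rightarrow> ('c, 'x, 's) density_elt) \<Rightarrow> (('c, 's) rel_structure \<times> ('c \<Rightarrow> 'x)) set" where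
  "summands X \<alpha> = {(D, f). \<exists>x\<in>univ X. \<exists>a. \<alpha> x = (D, f, a)}"

lemma finite_summands: "finite (univ X) \<Longrightarrow> finite (summands X \<alpha>)"
  by (rule finite_subset[of _ "(\<lambda>x. (fst (\<alpha> x), fst (snd (\<alpha> x)))) ` univ X"])
    (force simp: summands_def)+

lemma coalgebra_point:
  assumes "coalgebra \<A> X \<alpha>" "x \<in> univ X"
  obtains D f a where "(D, f) \<in> summands X \<alpha>" "a \<in> univ D" "\<alpha> x = (D, f, a)" "f a = x"
proof -
  obtain D f a where e: "\<alpha> x = (D, f, a)" by (rule prod_cases3)
  moreover have "\<alpha> x \<in> univ (density \<A> X)"
    using assms homD(1)[of \<alpha> X "density \<A> X" x] by (simp add: coalgebra_def)
  moreover have "f a = x" using assms e unfolding coalgebra_iff by blast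
  ultimately show ?thesis using that assms(2) by (auto simp: summands_def)
qed

lemma summandsD:
  assumes "coalgebra \<A> X \<alpha>" "(D, f) \<in> summands X \<alpha>"
  shows "D \<in> \<A>" "f \<in> hom D X" "b \<in> univ D \<Longrightarrow> \<alpha> (f b) = (D, f, b)"
proof -
  obtain x a where x: "x \<in> univ X" "\<alpha> x = (D, f, a)" using assms(2) by (auto simp: summands_def)
  have "\<alpha> x \<in> univ (density \<A> X)"
    using assms x(1) homD(1)[of \<alpha> X "density \<A> X" x] by (simp add: coalgebra_def)
  then show "D \<in> \<A>" "f \<in> hom D X" using x by simp_all
  show "b \<in> univ D \<Longrightarrow> \<alpha> (f b) = (D, f, b)" using assms x unfolding coalgebra_iff by blast
qed

text \<open>The relations of a coproduct lie in single summands, so \<alpha> sends \<open>t\<close>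
  into one copy of some \<open>D\<close>. Applying \<open>f\<close> to the resulting tuple recovers
  \<open>t\<close> by the counit law.\<close>

lemma coalgebra_rel:
  assumes \<alpha>: "coalgebra \<A> X \<alpha>" and X: "is_object \<B> X" and t: "t \<in> rel X R" "t \<noteq> []"
    and obj: "\<And>A. A \<in> \<A> \<Longrightarrow> is_object \<B> A"
  obtains D f s where "(D, f) \<in> summands X \<alpha>" "s \<in> rel D R" "set s \<subseteq> univ D" "t = map f s"
proof -
  have "map \<alpha> t \<in> rel (density \<A> X) R"
    using \<alpha> t homD(2)[of \<alpha> X "density \<A> X" t R] by (simp add: coalgebra_def)
  then obtain D f s where s: "D \<in> \<A>" "s \<in> rel D R" "map \<alpha> t = map (\<lambda>a. (D, f, a)) s"
    by (auto simp: rel_density)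
  have tX: "set t \<subseteq> univ X" using rel_subset_univ[OF X t(1)] .
  have len: "length t = length s" using arg_cong[OF s(3), of length] by simp
  have nth: "\<alpha> (t ! i) = (D, f, s ! i)" if "i < length t" for i
    using arg_cong[OF s(3), of "\<lambda>l. l ! i"] that len by simp
  have "t = map f s"
  proof (rule nth_equalityI)
    fix i assume i: "i < length t"
    then have "t ! i \<in> univ X" using tX by auto
    then have "f (s ! i) = t ! i" using \<alpha> nth[OF i] unfolding coalgebra_iff by blast
    then show "t ! i = map f s ! i" using i len by simp
  qed (simp add: len)
  \<comment> \<open>The entry at index 0 exists because \<open>t\<close> is nonempty, and it
    witnesses the pair.\<close>
  moreover have "(D, f) \<in> summands X \<alpha>"
    using nth[of 0] t(2) tX by (auto simp: summands_def intro!: bexI[of _ "t ! 0"])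
  ultimately show ?thesis using that s(2) rel_subset_univ[OF obj[OF s(1)] s(2)] by blast
qed

section \<open>Homomorphisms out of an object with a coalgebra\<close>

text \<open>This is the universal property of a coproduct: \<open>\<Phi>\<close> restricts a map to
  every copy, and \<open>\<Psi>\<close> glues a family, using \<alpha> to find the copy and the
  coordinate of each point.\<close>

lemma hom_coalgebra_eqpoll:
  fixes X :: "('d, 's) rel_structure" and \<A> :: "('c, 's) rel_structure set"
  assumes base: "(\<exists>\<sigma>. relational_signature \<sigma> \<and> \<B> = Rel_Structures \<sigma>) \<or> (\<exists>E. \<B> = Graphs E)"
    and C: "is_object \<B> C" and \<alpha>: "coalgebra \<A> C \<alpha>"
    and obj: "\<And>A. A \<in> \<A> \<Longrightarrow> is_object \<B> A"
  shows "hom C X \<approx> (\<Pi>\<^sub>E j\<in>summands C \<alpha>. hom (fst j) X)"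
    (is "_ \<approx> ?P")
proof -
  define \<Phi> :: "('a \<Rightarrow> 'd) \<Rightarrow> _" where "\<Phi> = (\<lambda>u. \<lambda>j\<in>summands C \<alpha>. comp_from (fst j) u (snd j))"
  define \<Psi> :: "(_ \<Rightarrow> 'c \<Rightarrow> 'd) \<Rightarrow> _" where "\<Psi> = (\<lambda>w. \<lambda>x\<in>univ C. case \<alpha> x of (D, f, a) \<Rightarrow> w (D, f) a)"
  have \<Psi>: "\<Psi> w (f b) = w (D, f) b"
    if "(D, f) \<in> summands C \<alpha>" "b \<in> univ D" for w :: "_ \<Rightarrow> 'c \<Rightarrow> 'd" and D f b
    using summandsD(3)[OF \<alpha> that] homD(1)[OF summandsD(2)[OF \<alpha> that(1)] that(2)]
    by (simp add: \<Psi>_def)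
  have \<Psi>hom: "\<Psi> w \<in> hom C X" if w: "w \<in> ?P" for w
  proof -
    have wh: "w (D, f) \<in> hom D X" if "(D, f) \<in> summands C \<alpha>" for D f
      using PiE_mem[OF w that] by simp
    have "\<Psi> w x \<in> univ X" if x: "x \<in> univ C" for x
      using coalgebra_point[OF \<alpha> x] \<Psi> homD(1)[OF wh] by metis
    moreover have "map (\<Psi> w) t \<in> rel X R" if t: "t \<in> rel C R" for t R
    proof -
      have "t \<noteq> []" using rel_not_Nil[OF base C] t by blast
      then obtain D f s where s: "(D, f) \<in> summands C \<alpha>" "s \<in> rel D R" "set s \<subseteq> univ D" "t = map f s"
        using coalgebra_rel[OF \<alpha> C t _ obj] by blast
      then have "map (\<Psi> w) t = map (w (D, f)) s" using \<Psi>[OF s(1)] by auto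
      then show ?thesis using homD(2)[OF wh[OF s(1)] s(2)] by simp
    qed
    ultimately show ?thesis by (simp add: hom_def[of C X] \<Psi>_def)
  qed
  have "\<Psi> (\<Phi> u) = u" if u: "u \<in> hom C X" for u
  proof (rule extensionalityI[OF _ homD(3)[OF u]])
    fix x assume x: "x \<in> univ C"
    then obtain D f a where "(D, f) \<in> summands C \<alpha>" "a \<in> univ D" "\<alpha> x = (D, f, a)" "f a = x"
      using coalgebra_point[OF \<alpha>] by blast
    then show "\<Psi> (\<Phi> u) x = u x" using x by (simp add: \<Psi>_def \<Phi>_def compose_eq)
  qed (simp add: \<Psi>_def)
  moreover have "\<Phi> (\<Psi> w) = w" if w: "w \<in> ?P" for w
  proof (rule extensionalityI[of _ "summands C \<alpha>"])
    fix j assume j: "j \<in> summands C \<alpha>"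
    obtain D f where jd: "j = (D, f)" by (cases j)
    have "comp_from D (\<Psi> w) f = w j"
    proof (rule extensionalityI[of _ "univ D"])
      show "w j \<in> extensional (univ D)" using homD(3)[OF PiE_mem[OF w j]] jd by simp
    qed (use \<Psi> j jd in \<open>simp_all add: compose_eq\<close>)
    then show "\<Phi> (\<Psi> w) j = w j" using j by (simp add: \<Phi>_def jd)
  qed (use w in \<open>simp_all add: \<Phi>_def PiE_def\<close>)
  moreover have "\<Phi> u \<in> ?P" if u: "u \<in> hom C X" for u
    using hom_compose[OF obj _ u] summandsD[OF \<alpha>] by (auto simp: \<Phi>_def)
  ultimately have "bij_betw \<Phi> (hom C X) ?P"
    using \<Psi>hom by (intro bij_betw_byWitness[where f' = \<Psi>]) auto
  then show ?thesis by (auto simp: eqpoll_def)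
qed

section \<open>From coalgebras back to membership in the class\<close>

text \<open>Closure under coproducts in \<open>component_based\<close> concerns structures over
  \<open>nat\<close> indexed by sets of naturals. Hence the copies of \<open>D\<close> are replaced
  by isomorphic \<open>N D\<close>, and the pairs \<open>(D, f)\<close> by their codes under
  \<open>e\<close>.\<close>

lemma coalgebra_iso_coprod:
  fixes N :: "('c, 's) rel_structure \<Rightarrow> ('n, 's) rel_structure"
  assumes base: "(\<exists>\<sigma>. relational_signature \<sigma> \<and> \<B> = Rel_Structures \<sigma>) \<or> (\<exists>E. \<B> = Graphs E)"
    and X: "is_object \<B> X" and \<alpha>: "coalgebra \<A> X \<alpha>"
    and obj: "\<And>A. A \<in> \<A> \<Longrightarrow> is_object \<B> A"
    and e: "inj_on e (summands X \<alpha>)"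
    and N: "\<And>D. D \<in> \<A> \<Longrightarrow> iso_objects D (N D)" "\<And>D. D \<in> \<A> \<Longrightarrow> is_object \<B> (N D)"
  shows "iso_objects X (coprod (e ` summands X \<alpha>) (\<lambda>i. N (fst (inv_into (summands X \<alpha>) e i))))"
proof -
  define J where "J = summands X \<alpha>"
  define A where "A i = N (fst (inv_into J e i))" for i
  have inv: "inv_into J e (e j) = j" if "j \<in> J" for j using e that by (simp add: J_def)
  have Ae: "A (e (D, f)) = N D" if "(D, f) \<in> J" for D f using inv[OF that] by (simp add: A_def)
  have "\<forall>D\<in>\<A>. \<exists>p q. p \<in> hom D (N D) \<and> q \<in> hom (N D) D \<and>
      (\<forall>a\<in>univ D. q (p a) = a) \<and> (\<forall>b\<in>univ (N D). p (q b) = b)"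
    by (intro ballI, drule N(1), elim iso_objectsE) blast
  then obtain p q where p: "\<And>D. D \<in> \<A> \<Longrightarrow> p D \<in> hom D (N D)"
    and q: "\<And>D. D \<in> \<A> \<Longrightarrow> q D \<in> hom (N D) D"
    and qp: "\<And>D a. D \<in> \<A> \<Longrightarrow> a \<in> univ D \<Longrightarrow> q D (p D a) = a"
    and pq: "\<And>D b. D \<in> \<A> \<Longrightarrow> b \<in> univ (N D) \<Longrightarrow> p D (q D b) = b"
    unfolding bchoice_iff by blast
  \<comment> \<open>\<open>u\<close> takes the coordinates given by \<alpha> and moves them to
    \<open>N D\<close>; \<open>v\<close> decodes the index, returns to \<open>D\<close> and embeds
    by \<open>f\<close>.\<close>
  define u where "u x = (case \<alpha> x of (D, f, a) \<Rightarrow> (e (D, f), p D a))" for x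
  define v where "v = (\<lambda>(i, b). case inv_into J e i of (D, f) \<Rightarrow> f (q D b))"
  have J\<A>: "D \<in> \<A>" "f \<in> hom D X" "b \<in> univ D \<Longrightarrow> \<alpha> (f b) = (D, f, b)" if "(D, f) \<in> J" for D f b
    using summandsD[OF \<alpha>] that by (auto simp: J_def)
  have u: "u (f b) = (e (D, f), p D b)" if "(D, f) \<in> J" "b \<in> univ D" for D f b
    using J\<A>(3)[OF that] by (simp add: u_def)
  have v: "v (e (D, f), b) = f (q D b)" if "(D, f) \<in> J" for D f b
    using inv[OF that] by (simp add: v_def)
  have cop: "is_object \<B> (coprod (e ` J) A)"
    by (rule is_object_coprod) (use Ae J\<A>(1) N(2) in auto)
  have copE: "\<exists>D f b. (D, f) \<in> J \<and> y = (e (D, f), b) \<and> b \<in> univ (N D)"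
    if y: "y \<in> univ (coprod (e ` J) A)" for y
  proof -
    obtain i b where i: "i \<in> e ` J" "y = (i, b)" "b \<in> univ (A i)"
      using y by (auto simp: coprod_def)
    then obtain D f where j: "i = e (D, f)" "(D, f) \<in> J" by force
    then have "(D, f) \<in> J \<and> y = (e (D, f), b) \<and> b \<in> univ (N D)" using i Ae by simp
    then show ?thesis by blast
  qed
  have uX: "u x \<in> univ (coprod (e ` J) A) \<and> v (u x) = x" if x: "x \<in> univ X" for x
  proof -
    obtain D f a where j: "(D, f) \<in> J" "a \<in> univ D" "f a = x"
      using coalgebra_point[OF \<alpha> x] unfolding J_def by metis
    have ux: "u x = (e (D, f), p D a)" using u[OF j(1,2)] j(3) by simp
    moreover have "p D a \<in> univ (A (e (D, f)))"
      using homD(1)[OF p[OF J\<A>(1)[OF j(1)]] j(2)] Ae[OF j(1)] by simp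
    ultimately have "u x \<in> univ (coprod (e ` J) A)" using j(1) by (simp add: coprod_def)
    moreover have "v (u x) = x" using v[OF j(1)] qp[OF J\<A>(1)[OF j(1)] j(2)] j(3) ux by simp
    ultimately show ?thesis ..
  qed
  have vY: "v y \<in> univ X \<and> u (v y) = y" if y: "y \<in> univ (coprod (e ` J) A)" for y
  proof -
    obtain D f b where j: "(D, f) \<in> J" "y = (e (D, f), b)" "b \<in> univ (N D)"
      using copE[OF y] by blast
    have qb: "q D b \<in> univ D" using homD(1)[OF q[OF J\<A>(1)[OF j(1)]] j(3)] .
    have "v y = f (q D b)" using v[OF j(1)] j(2) by simp
    then show ?thesis
      using homD(1)[OF J\<A>(2)[OF j(1)] qb] u[OF j(1) qb] pq[OF J\<A>(1)[OF j(1)] j(3)] j(2) by simp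
  qed
  have "restrict u (univ X) \<in> hom X (coprod (e ` J) A)"
  proof (rule hom_restrictI[OF _ _ X])
    fix t R assume t: "t \<in> rel X R"
    have "t \<noteq> []" using rel_not_Nil[OF base X] t by blast
    then obtain D f s where s: "(D, f) \<in> J" "s \<in> rel D R" "set s \<subseteq> univ D" "t = map f s"
      using coalgebra_rel[OF \<alpha> X t _ obj] unfolding J_def by blast
    then have "map u t = map (Pair (e (D, f))) (map (p D) s)" using u[OF s(1)] by auto
    moreover have "map (p D) s \<in> rel (A (e (D, f))) R"
      using homD(2)[OF p[OF J\<A>(1)] s(2)] s(1) Ae by simp
    ultimately show "map u t \<in> rel (coprod (e ` J) A) R"
      unfolding coprod_def rel_structure.simps using s(1) by (intro UN_I[of "e (D, f)"] image_eqI imageI)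
  qed (use uX in blast)
  moreover have "restrict v (univ (coprod (e ` J) A)) \<in> hom (coprod (e ` J) A) X"
  proof (rule hom_restrictI[OF _ _ cop])
    fix t R assume "t \<in> rel (coprod (e ` J) A) R"
    then obtain D f s where s: "(D, f) \<in> J" "s \<in> rel (A (e (D, f))) R" "t = map (Pair (e (D, f))) s"
      by (auto simp: coprod_def)
    then have "s \<in> rel (N D) R" using Ae by simp
    then have "map f (map (q D) s) \<in> rel X R"
      by (intro homD(2)[OF J\<A>(2)[OF s(1)]] homD(2)[OF q[OF J\<A>(1)[OF s(1)]]])
    then show "map v t \<in> rel X R" using v[OF s(1)] s(3) by (simp add: comp_def)
  qed (use vY in blast)
  ultimately have "iso_objects X (coprod (e ` J) A)"
    by (rule iso_objectsI) (use uX vY in simp_all)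
  then show ?thesis by (simp add: J_def A_def[abs_def])
qed

text \<open>A finite object has finitely many summands, each isomorphic to a member of
  \<open>\<Delta>\<close>, so closure under finite coproducts applies. An empty \<open>X\<close> has
  no summands and is covered by the empty coproduct.\<close>

lemma in_class_if_coalgebra:
  assumes base: "(\<exists>\<sigma>. relational_signature \<sigma> \<and> \<B> = Rel_Structures \<sigma>) \<or> (\<exists>E. \<B> = Graphs E)"
    and \<Delta>: "component_based \<B> \<Delta>" and \<A>: "connected_representatives \<B> \<Delta> \<A>"
    and X: "finite_object \<B> X" and \<alpha>: "coalgebra \<A> X \<alpha>"
  shows "in_class \<Delta> X"
proof -
  have obj: "\<And>A. A \<in> \<A> \<Longrightarrow> is_object \<B> A"
    using \<A> by (simp add: connected_representatives_def)
  note \<Delta>obj = component_basedD[OF \<Delta>]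
  have Xo: "is_object \<B> X" and fin: "finite (summands X \<alpha>)"
    using X finite_summands by (auto simp: finite_object_def)
  have "\<forall>D\<in>\<A>. \<exists>N. N \<in> \<Delta> \<and> iso_objects D N"
    using \<A> by (auto simp: connected_representatives_def in_class_def)
  then obtain N where N: "\<And>D. D \<in> \<A> \<Longrightarrow> N D \<in> \<Delta>" "\<And>D. D \<in> \<A> \<Longrightarrow> iso_objects D (N D)"
    unfolding bchoice_iff by metis
  obtain e :: "_ \<Rightarrow> nat" where e: "inj_on e (summands X \<alpha>)"
    using finite_imp_inj_to_nat_seg[OF fin] by blast
  define A where "A = (\<lambda>i. N (fst (inv_into (summands X \<alpha>) e i)))"
  have iso: "iso_objects X (coprod (e ` summands X \<alpha>) A)"
    unfolding A_def using coalgebra_iso_coprod[OF base Xo \<alpha> obj e N(2) \<Delta>obj[OF N(1)]] .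
  have "A i \<in> \<Delta>" if "i \<in> e ` summands X \<alpha>" for i
    using that e N(1) summandsD(1)[OF \<alpha>] by (auto simp: A_def)
  then have "in_class \<Delta> (coprod (e ` summands X \<alpha>) A)"
    by (rule component_based_coprod[OF \<Delta> finite_imageI[OF fin]])
  then obtain Z where "Z \<in> \<Delta>" "iso_objects (coprod (e ` summands X \<alpha>) A) Z"
    by (auto simp: in_class_def)
  then show ?thesis
    using iso_objects_trans[OF Xo \<Delta>obj iso] unfolding in_class_def by blast
qed

section \<open>Classification of the class and of the equivalence\<close>

theorem corollary1p2:
  fixes \<B> :: "'s base_category"
    and \<Delta> :: "(nat, 's) rel_structure set"
    and \<A> :: "('c, 's) rel_structure set"
  assumes base: "(\<exists>\<sigma>. relational_signature \<sigma> \<and> \<B> = Rel_Structures \<sigma>) \<or> (\<exists>E. \<B> = Graphs E)"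
    and \<Delta>: "component_based \<B> \<Delta>"
    and \<A>: "connected_representatives \<B> \<Delta> \<A>"
  shows "(\<forall>X :: ('x, 's) rel_structure. finite_object \<B> X \<longrightarrow>
            (in_class \<Delta> X \<longleftrightarrow> (\<exists>\<alpha>. coalgebra \<A> X \<alpha>))) \<and>
         (\<forall>(A :: ('a, 's) rel_structure) (B :: ('b, 's) rel_structure).
            finite_object \<B> A \<and> finite_object \<B> B \<longrightarrow>
            (hom_equiv \<Delta> A B \<longleftrightarrow> coalgebra_iso \<A> (cofree \<A> A) (cofree \<A> B)))"
proof (intro conjI allI impI iffI)
  have obj: "\<And>A. A \<in> \<A> \<Longrightarrow> is_object \<B> A"
    using \<A> by (simp add: connected_representatives_def)
  note \<Delta>obj = component_basedD[OF \<Delta>]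
  {
    fix X :: "('x, 's) rel_structure"
    assume X: "finite_object \<B> X" and "in_class \<Delta> X"
    then obtain Y where Y: "Y \<in> \<Delta>" "iso_objects X Y" by (auto simp: in_class_def)
    obtain \<alpha> where "coalgebra \<A> Y \<alpha>" using coalgebra_if_member[OF base \<Delta> \<A> Y(1)] by blast
    then show "\<exists>\<alpha>. coalgebra \<A> X \<alpha>"
      using coalgebra_transport[OF _ Y(2) _ obj] X by (auto simp: finite_object_def)
  next
    fix X :: "('x, 's) rel_structure"
    assume "finite_object \<B> X" "\<exists>\<alpha>. coalgebra \<A> X \<alpha>"
    then show "in_class \<Delta> X" using in_class_if_coalgebra[OF base \<Delta> \<A>] by blast
  next
    fix A :: "('a, 's) rel_structure" and B :: "('b, 's) rel_structure"
    assume AB: "hom_equiv \<Delta> A B"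
    have "hom D A \<approx> hom D B" if D: "D \<in> \<A>" for D
    proof -
      \<comment> \<open>\<open>hom_equiv\<close> speaks only of members of \<open>\<Delta>\<close>,
        so the bijection is carried over from an isomorphic \<open>C\<close>.\<close>
      obtain C where C: "C \<in> \<Delta>" "iso_objects D C"
        using \<A> D by (auto simp: connected_representatives_def in_class_def)
      note eq = iso_objects_hom_eqpoll[OF obj[OF D] \<Delta>obj[OF C(1)] C(2)]
      have "hom C A \<approx> hom C B" using AB C(1) by (simp add: hom_equiv_def)
      then show ?thesis using eq eqpoll_trans eqpoll_sym by metis
    qed
    then show "coalgebra_iso \<A> (cofree \<A> A) (cofree \<A> B)"
      using obj by (rule hom_eqpoll_imp_cofree_iso)
  next
    fix A :: "('a, 's) rel_structure" and B :: "('b, 's) rel_structure"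
    assume iso: "coalgebra_iso \<A> (cofree \<A> A) (cofree \<A> B)"
    show "hom_equiv \<Delta> A B"
      unfolding hom_equiv_def
    proof
      fix C assume C: "C \<in> \<Delta>"
      \<comment> \<open>A coalgebra on \<open>C\<close> serves here as its decomposition into
        representatives, for which the given isomorphism supplies bijections.\<close>
      obtain \<alpha> where \<alpha>: "coalgebra \<A> C \<alpha>" using coalgebra_if_member[OF base \<Delta> \<A> C] by blast
      have "hom C A \<approx> (\<Pi>\<^sub>E j\<in>summands C \<alpha>. hom (fst j) A)"
        by (rule hom_coalgebra_eqpoll[OF base \<Delta>obj[OF C] \<alpha> obj])
      also have "\<dots> \<approx> (\<Pi>\<^sub>E j\<in>summands C \<alpha>. hom (fst j) B)"
        using summandsD(1)[OF \<alpha>] cofree_iso_imp_hom_eqpoll[OF iso _ obj]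
        by (intro eqpoll_PiE) auto
      also have "\<dots> \<approx> hom C B"
        by (rule eqpoll_sym[OF hom_coalgebra_eqpoll[OF base \<Delta>obj[OF C] \<alpha> obj]])
      finally show "hom C A \<approx> hom C B" .
    qed
  }
qed

end
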